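(* Let $\delta\in(0,1)$, $\epsilon\in[0,1]$, and consider the noiseless case $\sigma_w=0$. (1) If $\inf_{0\le p\le1}\overline{M}_p(\epsilon)<\delta$, then for every $p_X\in\mathcal{F}_\epsilon$ the highest stable fixed point of $\Psi_{\lambda_*,p_*}$ is at zero; in other words, $\Psi_{\lambda_*,p_*}(\sigma^2)$ has a unique stable fixed point, and it is at zero. (2) If $$\sup_{\mu\ge0}\ \inf_{0\le p\le1}\ \inf_{\tau\ge0}\left[(1-\epsilon)\mathbb{E}(\eta_p(Z;\tau))^2+\epsilon\,\mathbb{E}(\eta_p(\mu+Z;\tau)-\mu)^2\right]>\delta ,$$ where $Z\sim N(0,1)$, then there exists a distribution $p_X\in\mathcal{F}_\epsilon$ for which $\Psi_{\lambda_*,p_*}$ has an extra stable fixed point in addition to zero.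
   Context: For $0\le p\le1$, $\lambda\ge0$, $u\in\mathbb{R}$: $\eta_p(u;\lambda)=\arg\min_{x\in\mathbb{R}}\frac12(u-x)^2+\lambda|x|^p$ (with $|x|^0=\mathbb{I}(x\neq0)$), the value $0$ being chosen when the minimizer is not unique. $\mathcal{F}_\epsilon$ is the set of probability distributions $p_X$ on $\mathbb{R}$ (with finite second moment) such that $P(X\ne0)\le\epsilon$ for $X\sim p_X$. State evolution map with optimal adaptation policy $(\lambda_*(\sigma),p_*(\sigma))\in\arg\min_{\lambda\ge0,\,0\le p\le1}\mathbb{E}|\eta_p(X+\sigma Z;\lambda)-X|^2$: for $\sigma\ge0$, $$\Psi_{\lambda_*,p_*}(\sigma^2)=\sigma_w^2+\frac1\delta\inf_{\lambda\ge0,\,0\le p\le1}\mathbb{E}\left|\eta_p(X+\sigma Z;\lambda)-X\right|^2,$$ with $X\sim p_X$ and $Z\sim N(0,1)$ independent. Stable fixed point: $\sigma_f>0$ with $\Psi(\sigma_f^2)=\sigma_f^2$ is stable if there is an open interval $I\ni\sigma_f$ such that $\Psi(\sigma^2)<\sigma^2$ for all $\sigma>\sigma_f$ in $I$ and $\Psi(\sigma^2)>\sigma^2$ for all $\sigma<\sigma_f$ in $I$. Zero is a stable fixed point if $\Psi(0)=0$ and there is $\sigma_i>0$ with $\Psi(\sigma^2)<\sigma^2$ for all $0<\sigma<\sigma_i$. $\overline{M}_p(\epsilon)=\inf_{\tau\ge0}\sup_{\mu\ge0}\left[(1-\epsilon)\mathbb{E}(\eta_p(Z;\tau))^2+\epsilon\,\mathbb{E}(\eta_p(\mu+Z;\tau)-\mu)^2\right]$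 with $Z\sim N(0,1)$. *)

theory Defs
  imports "HOL-Probability.Probability"
begin

definition lp_penalty :: "real \<Rightarrow> real \<Rightarrow> real" where
  "lp_penalty p x = (if p = 0 then (if x = 0 then 0 else 1) else \<bar>x\<bar> powr p)"

definition prox_objective :: "real \<Rightarrow> real \<Rightarrow> real \<Rightarrow> real \<Rightarrow> real" where
  "prox_objective p l u x = (u - x)\<^sup>2 / 2 + l * lp_penalty p x"

text \<open>
  For \<open>0 \<le> p \<le> 1\<close> and \<open>l \<ge> 0\<close> a minimizer exists, so the \<open>else\<close> branch below is
  reached exactly when the minimizer is not unique. In that range \<open>eta p l\<close> is
  nondecreasing and \<open>\<bar>eta p l u\<bar> \<le> \<bar>u\<bar>\<close>, hence all integrals below are integrals of
  integrable functions.
\<close>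
definition eta :: "real \<Rightarrow> real \<Rightarrow> real \<Rightarrow> real" where
  "eta p l u =
    (if \<exists>!x. is_arg_min (prox_objective p l u) (\<lambda>_. True) x
     then (THE x. is_arg_min (prox_objective p l u) (\<lambda>_. True) x)
     else 0)"

definition sparse_dists :: "real \<Rightarrow> real measure set" where
  "sparse_dists \<epsilon> =
    {P. prob_space P \<and> sets P = sets borel \<and> integrable P (\<lambda>x. x\<^sup>2) \<and>
        measure P {x. x \<noteq> 0} \<le> \<epsilon>}"

definition mse :: "real measure \<Rightarrow> real \<Rightarrow> real \<Rightarrow> real \<Rightarrow> real" where
  "mse P l p \<sigma> =
    (\<integral>(x, z). (eta p l (x + \<sigma> * z) - x)\<^sup>2 \<partial>(P \<Otimes>\<^sub>M std_normal_distribution))"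

text \<open>The argument \<open>s\<close> of the state evolution map is the variance \<open>\<sigma>\<^sup>2\<close>.\<close>
definition Psi :: "real measure \<Rightarrow> real \<Rightarrow> real \<Rightarrow> real \<Rightarrow> real" where
  "Psi P \<delta> \<sigma>w s =
    \<sigma>w\<^sup>2 + 1 / \<delta> * (INF (l, p) \<in> {0..} \<times> {0..1}. mse P l p (sqrt s))"

text \<open>
  A fixed point is identified by its standard deviation \<open>\<sigma>\<close>, while \<open>F\<close> acts on
  variances. As \<open>F\<close> is meaningful only for nonnegative arguments, the open interval
  around a positive fixed point is taken inside the nonnegative half-line.
\<close>
definition stable_fixed_point :: "(real \<Rightarrow> real) \<Rightarrow> real \<Rightarrow> bool" where
  "stable_fixed_point F \<sigma>f \<longleftrightarrow>
    (\<sigma>f > 0 \<and> F (\<sigma>f\<^sup>2) = \<sigma>f\<^sup>2 \<and>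
      (\<exists>a b. 0 \<le> a \<and> a < \<sigma>f \<and> \<sigma>f < b \<and>
        (\<forall>\<sigma>. \<sigma>f < \<sigma> \<and> \<sigma> < b \<longrightarrow> F (\<sigma>\<^sup>2) < \<sigma>\<^sup>2) \<and>
        (\<forall>\<sigma>. a < \<sigma> \<and> \<sigma> < \<sigma>f \<longrightarrow> F (\<sigma>\<^sup>2) > \<sigma>\<^sup>2))) \<or>
    (\<sigma>f = 0 \<and> F 0 = 0 \<and>
      (\<exists>\<sigma>i > 0. \<forall>\<sigma>. 0 < \<sigma> \<and> \<sigma> < \<sigma>i \<longrightarrow> F (\<sigma>\<^sup>2) < \<sigma>\<^sup>2))"

definition two_point_risk :: "real \<Rightarrow> real \<Rightarrow> real \<Rightarrow> real \<Rightarrow> real" where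
  "two_point_risk \<epsilon> p \<tau> \<mu> =
    (1 - \<epsilon>) * (\<integral>z. (eta p \<tau> z)\<^sup>2 \<partial>std_normal_distribution) +
    \<epsilon> * (\<integral>z. (eta p \<tau> (\<mu> + z) - \<mu>)\<^sup>2 \<partial>std_normal_distribution)"

text \<open>
  Extended reals are used so that the suprema and infima are the order-theoretic ones
  without a boundedness side condition.
\<close>
definition M_bar :: "real \<Rightarrow> real \<Rightarrow> ereal" where
  "M_bar p \<epsilon> = (INF \<tau>\<in>{0..}. SUP \<mu>\<in>{0..}. ereal (two_point_risk \<epsilon> p \<tau> \<mu>))"

end

theory Submission
  imports Defs
begin

text \<open>
  By the scaling \<open>\<eta>\<^sub>p(\<sigma>u; \<tau>\<sigma>\<^bsup>2-p\<^esup>) = \<sigma> \<eta>\<^sub>p(u; \<tau>)\<close>, the quotient \<open>\<Psi>(\<sigma>\<^sup>2) / \<sigma>\<^sup>2\<close> is \<open>1 / \<delta>\<close> times the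
  infimum over \<open>p, \<tau>\<close> of the mean of \<open>risk p \<tau> (X / \<sigma>)\<close>. If the minimax two-point risk is below
  \<open>\<delta>\<close>, one pair \<open>p, \<tau>\<close> keeps this quotient below one for all \<open>\<sigma>\<close>, which is the first claim.

  For the second claim, a two-point distribution with mass \<open>q < \<delta>\<close> off zero has quotient above one
  at some \<open>\<sigma>\<close>, whereas hard thresholding makes it less than one both for small and for large
  \<open>\<sigma>\<close>. Continuity gives a fixed point, but not necessarily one where the sign of \<open>\<Psi>(\<sigma>\<^sup>2) - \<sigma>\<^sup>2\<close> changes
  strictly. For that a mass \<open>\<theta>\<close> is moved to a far point: its risk is almost at least one for every
  \<open>p, \<tau>\<close>, so the quotient is strictly increasing in \<open>\<theta>\<close> at the level one, and as it is
  Lipschitz in \<open>1 / \<sigma>\<close>, almost every \<open>\<theta>\<close> yields finitely many crossings.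
\<close>

subsection \<open>The proximal map\<close>

text \<open>A far signal costs almost one because \<open>p \<le> 1\<close> makes the bias
  \<open>u - prox p l u\<close> nonincreasing beyond the dead zone. There the bias cannot follow the
  noise, so shrinkage gains nothing, except on the rare event that the observation falls below 2.

  The obstacle is the infimum over \<open>l\<close> and \<open>p\<close>: the range of
  \<open>l\<close> is not compact, \<open>eta\<close> may jump, and neither attainment nor
  differentiability of the infimum is available. So every estimate is uniform in \<open>l\<close>
  and \<open>p\<close> and passes to the infimum as an inequality, and crossings are counted by
  measure instead of by derivatives. Uniform regularity in the signal comes from tilting the
  Gaussian measure, which moves the signal out of the argument of \<open>eta\<close>.

  For \<open>\<epsilon> \<ge> \<delta>\<close> the hypothesis of the second claim concerns too large
  a mass, so the barrier at mass \<delta> is proved independently. A bound of almost one at the far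
  atom gives only almost \<delta> there. The strict excess comes from a dichotomy: a dead zone
  reaching 3 pushes the far risk strictly above one, and a shorter one costs a fixed amount at the
  zero atom.\<close>

abbreviation is_prox :: "real \<Rightarrow> real \<Rightarrow> real \<Rightarrow> real \<Rightarrow> bool" where
  "is_prox p l u \<equiv> is_arg_min (prox_objective p l u) (\<lambda>_. True)"

text \<open>An arbitrary selection at ties. Minimality alone makes it monotone, and it differs from
  \<open>eta\<close> on a countable set only, which the Gaussian noise does not see
  (\<open>risk_eq_prox\<close>).\<close>

definition prox :: "real \<Rightarrow> real \<Rightarrow> real \<Rightarrow> real" where
  "prox p l u = (SOME x. is_prox p l u x)"

lemma is_prox_iff: "is_prox p l u x \<longleftrightarrow> (\<forall>y. prox_objective p l u x \<le> prox_objective p l u y)"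
  by (simp add: is_arg_min_linorder)

lemma lp_penalty_nonneg: "0 \<le> lp_penalty p x"
  by (simp add: lp_penalty_def)

lemma lp_penalty_zero [simp]: "lp_penalty p 0 = 0"
  by (simp add: lp_penalty_def)

lemma lp_penalty_minus [simp]: "lp_penalty p (- x) = lp_penalty p x"
  by (simp add: lp_penalty_def)

lemma lp_penalty_mono:
  assumes "0 \<le> p" "\<bar>x\<bar> \<le> \<bar>y\<bar>"
  shows "lp_penalty p x \<le> lp_penalty p y"
  using assms by (auto simp: lp_penalty_def intro: powr_mono2)

lemma lp_penalty_scale:
  assumes "0 < c"
  shows "lp_penalty p (c * x) = c powr p * lp_penalty p x"
  using assms by (auto simp: lp_penalty_def abs_mult powr_mult)

text \<open>The penalty for \<open>p = 0\<close> is discontinuous at 0, so compactness serves only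
  for \<open>p > 0\<close>, where points beyond \<bar>u\<bar> lose against \<open>u\<close>. For
  \<open>p = 0\<close> all nonzero points pay the same penalty, which leaves 0 and \<open>u\<close>
  as candidates.\<close>

lemma prox_exists:
  assumes "0 \<le> p" "0 \<le> l"
  shows "\<exists>x. is_prox p l u x"
proof (cases "p = 0")
  case True
  define x where "x = (if prox_objective p l u 0 \<le> prox_objective p l u u then 0 else u)"
  have "prox_objective p l u x \<le> prox_objective p l u y" for y
  proof (cases "y = 0")
    case False
    then have "prox_objective p l u u \<le> prox_objective p l u y"
      using True assms by (auto simp: prox_objective_def lp_penalty_def)
    then show ?thesis by (auto simp: x_def)
  qed (auto simp: x_def)
  then show ?thesis by (auto simp: is_prox_iff)
next
  case False
  have "continuous_on {-\<bar>u\<bar>..\<bar>u\<bar>} (\<lambda>x. \<bar>x\<bar> powr p)"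
    using False assms by (intro continuous_on_powr' continuous_intros) auto
  then have "continuous_on {-\<bar>u\<bar>..\<bar>u\<bar>} (prox_objective p l u)"
    unfolding prox_objective_def lp_penalty_def using False
    by (auto intro!: continuous_intros)
  then obtain x where x: "x \<in> {-\<bar>u\<bar>..\<bar>u\<bar>}"
    "\<And>y. y \<in> {-\<bar>u\<bar>..\<bar>u\<bar>} \<Longrightarrow> prox_objective p l u x \<le> prox_objective p l u y"
    using continuous_attains_inf[of "{-\<bar>u\<bar>..\<bar>u\<bar>}" "prox_objective p l u"] by auto
  have "prox_objective p l u x \<le> prox_objective p l u y" for y
  proof (cases "\<bar>y\<bar> \<le> \<bar>u\<bar>")
    case True
    then show ?thesis by (intro x) auto
  next
    case False
    have "prox_objective p l u u \<le> prox_objective p l u y"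
      using lp_penalty_mono[of p u y] False assms
      by (auto simp: prox_objective_def intro!: add_increasing mult_left_mono)
    moreover have "prox_objective p l u x \<le> prox_objective p l u u"
      by (intro x(2)) (auto simp: abs_if)
    ultimately show ?thesis by (rule order_trans[rotated])
  qed
  then show ?thesis by (auto simp: is_prox_iff)
qed

lemma is_prox_prox:
  assumes "0 \<le> p" "0 \<le> l"
  shows "is_prox p l u (prox p l u)"
  unfolding prox_def using prox_exists[OF assms] by (rule someI_ex)

text \<open>Adding the two optimality inequalities cancels the penalty, whatever its shape.\<close>

lemma is_prox_mono:
  assumes "is_prox p l u x" "is_prox p l v y" "u < v"
  shows "x \<le> y"
proof -
  have "prox_objective p l u x \<le> prox_objective p l u y"
    "prox_objective p l v y \<le> prox_objective p l v x"
    using assms by (auto simp: is_prox_iff)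
  then have "(v - u) * (y - x) \<ge> 0"
    unfolding prox_objective_def by (simp add: power2_eq_square field_simps)
  with \<open>u < v\<close> show ?thesis by (simp add: zero_le_mult_iff)
qed

lemma is_prox_zero:
  assumes "0 \<le> l" "is_prox p l 0 x"
  shows "x = 0"
proof -
  have "x\<^sup>2 / 2 + l * lp_penalty p x \<le> 0"
    using assms(2)[unfolded is_prox_iff, rule_format, of 0] by (simp add: prox_objective_def)
  moreover have "0 \<le> l * lp_penalty p x"
    using assms by (simp add: lp_penalty_nonneg)
  ultimately have "x\<^sup>2 / 2 \<le> 0" by linarith
  then show ?thesis by simp
qed

text \<open>Covers both symmetries used later: reflection with \<open>c = -1\<close>,
  \<open>k = 1\<close>, and change of noise level with \<open>c = \<sigma>\<close>,
  \<open>k = \<sigma>\<^sup>2\<close>.\<close>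

lemma is_prox_affine:
  assumes "\<And>x. prox_objective p l' u' (c * x) = k * prox_objective p l u x" "0 < k" "c \<noteq> 0"
  shows "is_prox p l' u' (c * x) \<longleftrightarrow> is_prox p l u x"
proof -
  have "(\<forall>y. prox_objective p l' u' (c * x) \<le> prox_objective p l' u' y) \<longleftrightarrow>
        (\<forall>y. prox_objective p l' u' (c * x) \<le> prox_objective p l' u' (c * y))"
    by (metis assms(3) nonzero_mult_div_cancel_left times_divide_eq_right)
  then show ?thesis
    unfolding is_prox_iff using assms by simp
qed

lemma eta_eqI:
  assumes "\<And>y. is_prox p l u y \<longleftrightarrow> y = x"
  shows "eta p l u = x"
  using assms by (auto simp: eta_def)

lemma eta_affine:
  assumes "\<And>x. prox_objective p l' u' (c * x) = k * prox_objective p l u x" "0 < k" "c \<noteq> 0"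
  shows "eta p l' u' = c * eta p l u"
proof (cases "\<exists>!x. is_prox p l u x")
  case True
  then obtain x where x: "\<And>y. is_prox p l u y \<longleftrightarrow> y = x" by (auto simp: Ex1_def)
  have "is_prox p l' u' y \<longleftrightarrow> y = c * x" for y
  proof -
    have "is_prox p l' u' (c * (y / c)) \<longleftrightarrow> y / c = x"
      using is_prox_affine[OF assms, of "y / c"] x by simp
    then show ?thesis using assms(3) by (auto simp: field_simps)
  qed
  then show ?thesis using eta_eqI x by metis
next
  case False
  have "\<not> (\<exists>!x. is_prox p l' u' x)"
  proof
    assume "\<exists>!x. is_prox p l' u' x"
    then obtain x where x: "\<And>y. is_prox p l' u' y \<longleftrightarrow> y = x" by (auto simp: Ex1_def)
    have "is_prox p l u y \<longleftrightarrow> y = x / c" for y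
      using is_prox_affine[OF assms, of y] x[of "c * y"] assms(3) by (auto simp: field_simps)
    with False show False by auto
  qed
  with False show ?thesis by (simp add: eta_def)
qed

lemma eta_minus: "eta p l (- u) = - eta p l u"
  using eta_affine[of p l "-u" "-1" 1 l u]
  by (simp add: prox_objective_def power2_commute)

lemma eta_scale:
  assumes "0 < \<sigma>"
  shows "eta p (t * \<sigma> powr (2 - p)) (\<sigma> * u) = \<sigma> * eta p t u"
proof (rule eta_affine[where k = "\<sigma>\<^sup>2"])
  fix x
  have "\<sigma> powr (2 - p) * \<sigma> powr p = \<sigma>\<^sup>2"
    using assms by (simp flip: powr_add)
  then have "t * \<sigma> powr (2 - p) * lp_penalty p (\<sigma> * x) = \<sigma>\<^sup>2 * (t * lp_penalty p x)"
    using assms by (simp add: lp_penalty_scale)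
  then show "prox_objective p (t * \<sigma> powr (2 - p)) (\<sigma> * u) (\<sigma> * x) = \<sigma>\<^sup>2 * prox_objective p t u x"
    unfolding prox_objective_def by (simp add: power2_eq_square algebra_simps)
qed (use assms in auto)

lemma is_prox_bounds:
  assumes "0 \<le> p" "0 \<le> l" "0 \<le> u" "is_prox p l u x"
  shows "0 \<le> x" "x \<le> u"
proof -
  show "0 \<le> x"
  proof (cases "u = 0")
    case True
    then show ?thesis using is_prox_zero assms by auto
  next
    case False
    then have "prox p l 0 \<le> x"
      using is_prox_mono[OF is_prox_prox assms(4)] assms by auto
    then show ?thesis
      using is_prox_zero[OF \<open>0 \<le> l\<close> is_prox_prox[of p l 0]] assms by simp
  qed
  show "x \<le> u"
  proof (rule ccontr)
    assume "\<not> x \<le> u"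
    then have "(u - x)\<^sup>2 > 0" by simp
    moreover have "l * lp_penalty p u \<le> l * lp_penalty p x"
      using \<open>\<not> x \<le> u\<close> assms by (intro mult_left_mono lp_penalty_mono) auto
    ultimately have "prox_objective p l u u < prox_objective p l u x"
      unfolding prox_objective_def diff_self zero_power2 by linarith
    with assms(4) show False by (auto simp: is_prox_iff not_le[symmetric])
  qed
qed

lemma is_prox_minus: "is_prox p l (- u) (- x) \<longleftrightarrow> is_prox p l u x"
  using is_prox_affine[of p l "-u" "-1" 1 l u x]
  by (simp add: prox_objective_def power2_commute)

lemma is_prox_abs_le:
  assumes "0 \<le> p" "0 \<le> l" "is_prox p l u x"
  shows "\<bar>x\<bar> \<le> \<bar>u\<bar>"
proof (cases "0 \<le> u")
  case True
  then show ?thesis using is_prox_bounds[OF assms(1,2) _ assms(3)] by auto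
next
  case False
  then show ?thesis
    using is_prox_bounds[of p l "-u" "-x"] assms is_prox_minus[of p l u x] by auto
qed

lemma abs_eta_le:
  assumes "0 \<le> p" "0 \<le> l"
  shows "\<bar>eta p l u\<bar> \<le> \<bar>u\<bar>"
proof (cases "\<exists>!x. is_prox p l u x")
  case True
  then have "is_prox p l u (eta p l u)"
    unfolding eta_def using theI'[OF True] by simp
  then show ?thesis using is_prox_abs_le assms by blast
qed (simp add: eta_def)

lemma eta_no_penalty: "eta p 0 u = u"
proof (rule eta_eqI)
  fix y
  show "is_prox p 0 u y \<longleftrightarrow> y = u"
  proof
    assume "is_prox p 0 u y"
    then have "prox_objective p 0 u y \<le> prox_objective p 0 u u" by (simp add: is_prox_iff)
    then show "y = u" by (simp add: prox_objective_def)
  qed (simp add: is_prox_iff prox_objective_def)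
qed

text \<open>The candidates 0 and \<open>u\<close> cost u^2/2 and a^2/2, so the penalty weight a^2/2
  puts the threshold at \<open>a\<close>. At \<bar>u\<bar> = a both are optimal and the convention
  for ties gives 0.\<close>

lemma eta_hard:
  assumes "0 < a"
  shows "eta 0 (a\<^sup>2 / 2) u = (if a < \<bar>u\<bar> then u else 0)"
proof -
  have obj: "prox_objective 0 (a\<^sup>2 / 2) u x = (u - x)\<^sup>2 / 2 + (if x = 0 then 0 else a\<^sup>2 / 2)" for x
    by (simp add: prox_objective_def lp_penalty_def)
  have nz: "a\<^sup>2 / 2 \<le> prox_objective 0 (a\<^sup>2 / 2) u x" if "x \<noteq> 0" for x
    using that by (simp add: obj)
  have at_0: "prox_objective 0 (a\<^sup>2 / 2) u 0 = u\<^sup>2 / 2" by (simp add: obj)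
  have at_u: "u \<noteq> 0 \<Longrightarrow> prox_objective 0 (a\<^sup>2 / 2) u u = a\<^sup>2 / 2" by (simp add: obj)
  consider "a < \<bar>u\<bar>" | "\<bar>u\<bar> < a" | "a = \<bar>u\<bar>" by linarith
  then show ?thesis
  proof cases
    case 1
    then have "u \<noteq> 0" using assms by auto
    have sq: "a\<^sup>2 < u\<^sup>2" using 1 assms by (metis power2_abs power_strict_mono less_imp_le zero_less_numeral)
    have "is_prox 0 (a\<^sup>2 / 2) u y \<longleftrightarrow> y = u" for y
    proof
      assume "is_prox 0 (a\<^sup>2 / 2) u y"
      then have le: "prox_objective 0 (a\<^sup>2 / 2) u y \<le> a\<^sup>2 / 2"
        using at_u[OF \<open>u \<noteq> 0\<close>] unfolding is_prox_iff by metis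
      then have "y \<noteq> 0" using at_0 sq by auto
      with le show "y = u" by (simp add: obj)
    next
      assume "y = u"
      then show "is_prox 0 (a\<^sup>2 / 2) u y"
        using at_u[OF \<open>u \<noteq> 0\<close>] at_0 nz sq unfolding is_prox_iff
        by (metis less_eq_real_def divide_strict_right_mono zero_less_numeral)
    qed
    then have "eta 0 (a\<^sup>2 / 2) u = u" by (rule eta_eqI)
    with 1 show ?thesis by simp
  next
    case 2
    then have sq: "u\<^sup>2 < a\<^sup>2" by (metis power2_abs power_strict_mono abs_ge_zero zero_less_numeral)
    have "is_prox 0 (a\<^sup>2 / 2) u y \<longleftrightarrow> y = 0" for y
    proof
      assume "is_prox 0 (a\<^sup>2 / 2) u y"
      then have "prox_objective 0 (a\<^sup>2 / 2) u y \<le> u\<^sup>2 / 2"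
        using at_0 unfolding is_prox_iff by metis
      with nz[of y] sq show "y = 0" by linarith
    next
      assume "y = 0"
      then show "is_prox 0 (a\<^sup>2 / 2) u y"
        using at_0 nz sq unfolding is_prox_iff
        by (metis order.trans order_refl less_eq_real_def divide_strict_right_mono zero_less_numeral)
    qed
    then have "eta 0 (a\<^sup>2 / 2) u = 0" by (rule eta_eqI)
    with 2 show ?thesis by simp
  next
    case 3
    then have "u \<noteq> 0" using assms by auto
    have sq: "a\<^sup>2 = u\<^sup>2" using 3 by simp
    have "is_prox 0 (a\<^sup>2 / 2) u 0" "is_prox 0 (a\<^sup>2 / 2) u u"
      using at_0 at_u[OF \<open>u \<noteq> 0\<close>] nz sq unfolding is_prox_iff by (metis order_refl)+
    then have "\<not> (\<exists>!x. is_prox 0 (a\<^sup>2 / 2) u x)"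
      using \<open>u \<noteq> 0\<close> by blast
    then show ?thesis using 3 by (simp add: eta_def)
  qed
qed

section \<open>The monotone selection of minimizers and its bias\<close>

lemma prox_mono:
  assumes "0 \<le> p" "0 \<le> l" "u \<le> v"
  shows "prox p l u \<le> prox p l v"
  using is_prox_mono[OF is_prox_prox is_prox_prox, of p l u v] assms
  by (cases "u = v") auto

lemma prox_zero: "0 \<le> p \<Longrightarrow> 0 \<le> l \<Longrightarrow> prox p l 0 = 0"
  using is_prox_zero is_prox_prox by blast

lemma prox_bounds:
  assumes "0 \<le> p" "0 \<le> l" "0 \<le> u"
  shows "0 \<le> prox p l u" "prox p l u \<le> u"
  using is_prox_bounds[OF assms is_prox_prox] assms by auto

lemma prox_nonpos:
  assumes "0 \<le> p" "0 \<le> l" "u \<le> 0"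
  shows "prox p l u \<le> 0"
  using prox_mono[OF assms] prox_zero assms by simp

text \<open>A point with several minimizers is a jump of every monotone selection of minimizers.\<close>
lemma countable_eta_neq_prox:
  assumes "0 \<le> p" "0 \<le> l"
  shows "countable {u. eta p l u \<noteq> prox p l u}"
proof -
  have "mono (prox p l)"
    using prox_mono[OF assms] by (auto intro: monoI)
  then have "countable {u. \<not> isCont (prox p l) u}"
    by (rule mono_ctble_discont)
  moreover have "{u. eta p l u \<noteq> prox p l u} \<subseteq> {u. \<not> isCont (prox p l) u}"
  proof safe
    fix u assume neq: "eta p l u \<noteq> prox p l u" and cont: "isCont (prox p l) u"
    have lim: "(prox p l \<longlongrightarrow> prox p l u) (at_left u)" "(prox p l \<longlongrightarrow> prox p l u) (at_right u)"
      using cont by (auto simp: isCont_def filterlim_at_split)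
    have "x = prox p l u" if x: "is_prox p l u x" for x
    proof (rule antisym)
      have "eventually (\<lambda>v. x \<le> prox p l v) (at_right u)"
        using is_prox_mono[OF x is_prox_prox[OF assms]]
        by (auto simp: eventually_at_right[OF less_add_one] intro!: exI[of _ "u + 1"])
      then show "x \<le> prox p l u"
        using tendsto_lowerbound[OF lim(2)] by simp
      have "eventually (\<lambda>v. prox p l v \<le> x) (at_left u)"
        using is_prox_mono[OF is_prox_prox[OF assms] x]
        by (auto simp: eventually_at_left[of "u - 1"] intro!: exI[of _ "u - 1"])
      then show "prox p l u \<le> x"
        using tendsto_upperbound[OF lim(1)] by simp
    qed
    then have "eta p l u = prox p l u"
      using is_prox_prox[OF assms] by (intro eta_eqI) auto
    with neq show False by simp
  qed
  ultimately show ?thesis by (rule countable_subset[rotated])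
qed

lemma borel_measurable_prox [measurable]:
  assumes "0 \<le> p" "0 \<le> l"
  shows "prox p l \<in> borel_measurable borel"
  using prox_mono[OF assms] by (intro borel_measurable_mono monoI)

lemma borel_measurable_eta:
  assumes "0 \<le> p" "0 \<le> l"
  shows "eta p l \<in> borel_measurable borel"
  by (rule measurable_discrete_difference[OF borel_measurable_prox[OF assms]
        countable_eta_neq_prox[OF assms]]) auto

text \<open>First-order condition at a minimizer away from the kink. On the positive half-line
  \<open>x powr p\<close> equals the penalty also for \<open>p = 0\<close>, where the condition says
  that the bias is zero.\<close>

lemma prox_stationary:
  assumes "0 \<le> p" "0 \<le> l" "0 < prox p l u"
  shows "u - prox p l u = l * p * prox p l u powr (p - 1)"
proof -
  define x where "x = prox p l u"
  have "0 < x" using assms by (simp add: x_def)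
  have "((\<lambda>y. (u - y)\<^sup>2 / 2 + l * y powr p) has_real_derivative (-(u - x) + l * (p * x powr (p - 1)))) (at x)"
    using \<open>0 < x\<close> by (auto intro!: derivative_eq_intros simp: power2_eq_square)
  moreover have "(u - x)\<^sup>2 / 2 + l * x powr p \<le> (u - y)\<^sup>2 / 2 + l * y powr p" if "\<bar>x - y\<bar> < x" for y
  proof -
    have "0 < y" using that by linarith
    moreover have "prox_objective p l u x \<le> prox_objective p l u y"
      using is_prox_prox[of p l u] assms by (auto simp: x_def is_prox_iff)
    ultimately show ?thesis
      using \<open>0 < x\<close> by (auto simp: prox_objective_def lp_penalty_def split: if_splits)
  qed
  ultimately have "-(u - x) + l * (p * x powr (p - 1)) = 0"
    using DERIV_local_min[of _ _ x x] \<open>0 < x\<close> by blast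
  then show ?thesis by (simp add: x_def)
qed

text \<open>Here concavity of the penalty enters: by stationarity the bias is a multiple of
  \<open>x powr (p - 1)\<close>, whose exponent is nonpositive, and \<open>x\<close> grows with the
  observation.\<close>

lemma prox_residual_antimono:
  assumes "0 \<le> p" "p \<le> 1" "0 \<le> l" "0 < prox p l u" "u \<le> v"
  shows "v - prox p l v \<le> u - prox p l u"
proof -
  have le: "prox p l u \<le> prox p l v"
    using assms by (intro prox_mono)
  then have "prox p l v powr (p - 1) \<le> prox p l u powr (p - 1)"
    using assms by (intro powr_mono2') auto
  then show ?thesis
    using prox_stationary[of p l u] prox_stationary[of p l v] assms le
    by (auto intro!: mult_left_mono)
qed

subsection \<open>Lower bounds for the Gaussian risk\<close>

abbreviation N01 :: "real measure" where "N01 \<equiv> std_normal_distribution"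

interpretation N01: real_distribution N01
  by (rule real_dist_normal_dist)

definition risk :: "real \<Rightarrow> real \<Rightarrow> real \<Rightarrow> real" where
  "risk p l m = (\<integral>z. (eta p l (m + z) - m)\<^sup>2 \<partial>N01)"

lemma two_point_risk_eq: "two_point_risk \<epsilon> p l m = (1 - \<epsilon>) * risk p l 0 + \<epsilon> * risk p l m"
  by (simp add: two_point_risk_def risk_def)

lemma N01_moments:
  "integrable N01 (\<lambda>z. z)" "integrable N01 (\<lambda>z. z\<^sup>2)"
  "(\<integral>z. z \<partial>N01) = 0" "(\<integral>z. z\<^sup>2 \<partial>N01) = 1"
  using integrable_std_normal_distribution_moment[of 1] integrable_std_normal_distribution_moment[of 2]
    integral_std_normal_distribution_moment_odd[of 1] std_normal_distribution_even_moments(1)[of 1]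
  by simp_all

lemma N01_integrable_quadratic:
  fixes f :: "real \<Rightarrow> real"
  assumes [measurable]: "f \<in> borel_measurable borel" and "\<And>z. \<bar>f z\<bar> \<le> a + b * z\<^sup>2"
  shows "integrable N01 f"
proof (rule Bochner_Integration.integrable_bound)
  show "integrable N01 (\<lambda>z. a + b * z\<^sup>2)"
    using N01_moments by simp
  show "AE z in N01. norm (f z) \<le> norm (a + b * z\<^sup>2)"
    using assms(2) by (auto intro: order.trans[OF _ abs_ge_self])
qed simp

lemma integrable_indicator_N01 [simp]:
  assumes "A \<in> sets borel"
  shows "integrable N01 (indicator A :: real \<Rightarrow> real)"
proof (rule N01_integrable_quadratic[of _ 1 0])
  show "indicator A \<in> borel_measurable borel" using assms by (rule borel_measurable_indicator)
qed (simp add: indicator_def)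

lemma N01_pos:
  assumes "a < b"
  shows "0 < N01.prob {a..<b}"
proof (rule ccontr)
  assume "\<not> ?thesis"
  then have "emeasure N01 {a..<b} = 0"
    by (simp add: N01.emeasure_eq_measure not_less measure_le_0_iff)
  then have "{a..<b} \<in> null_sets N01" by auto
  then have "AE x in lborel. x \<in> {a..<b} \<longrightarrow> ennreal (std_normal_density x) = 0"
    by (simp add: null_sets_density_iff)
  then have "AE x in lborel. x \<notin> {a..<b}"
    by eventually_elim (metis ennreal_eq_0_iff normal_density_pos not_le zero_less_one)
  then have "emeasure lborel {a..<b} = 0"
    by (subst (asm) AE_iff_measurable[of "{a..<b}"]) auto
  with assms show False by simp
qed

lemma AE_eta_eq_prox:
  assumes "0 \<le> p" "0 \<le> l"
  shows "AE z in N01. eta p l (m + z) = prox p l (m + z)"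
proof -
  have "countable ((\<lambda>u. u - m) ` {u. eta p l u \<noteq> prox p l u})"
    using countable_eta_neq_prox[OF assms] by (rule countable_image)
  then have "{z. eta p l (m + z) \<noteq> prox p l (m + z)} \<in> null_sets lborel"
    by (intro countable_imp_null_set_lborel, elim countable_subset[rotated]) (auto simp: image_iff intro!: exI[of _ "m + _"])
  then have "AE z in lborel. eta p l (m + z) = prox p l (m + z)"
    by (rule AE_I') auto
  then show ?thesis
    by (subst AE_density) (auto elim: AE_mp)
qed

lemma risk_eq_prox:
  assumes "0 \<le> p" "0 \<le> l"
  shows "risk p l m = (\<integral>z. (prox p l (m + z) - m)\<^sup>2 \<partial>N01)"
  unfolding risk_def
proof (rule integral_cong_AE)
  show "AE z in N01. (eta p l (m + z) - m)\<^sup>2 = (prox p l (m + z) - m)\<^sup>2"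
    using AE_eta_eq_prox[OF assms, of m] by eventually_elim simp
qed (use borel_measurable_eta[OF assms] borel_measurable_prox[OF assms] in measurable)

lemma square_error_le:
  fixes x m z :: real
  assumes "\<bar>x\<bar> \<le> \<bar>m + z\<bar>"
  shows "(x - m)\<^sup>2 \<le> 8 * m\<^sup>2 + 2 * z\<^sup>2"
proof -
  have "\<bar>x - m\<bar> \<le> 2 * \<bar>m\<bar> + \<bar>z\<bar>" using assms by linarith
  then have "(x - m)\<^sup>2 \<le> (2 * \<bar>m\<bar> + \<bar>z\<bar>)\<^sup>2"
    using power_mono[of "\<bar>x - m\<bar>" _ 2] by simp
  also have "\<dots> \<le> (2 * \<bar>m\<bar> + \<bar>z\<bar>)\<^sup>2 + (2 * \<bar>m\<bar> - \<bar>z\<bar>)\<^sup>2" by simp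
  also have "\<dots> = 8 * m\<^sup>2 + 2 * z\<^sup>2" by (simp add: power2_eq_square algebra_simps abs_mult_self_eq)
  finally show ?thesis .
qed

lemma integrable_risk:
  assumes "0 \<le> p" "0 \<le> l"
  shows "integrable N01 (\<lambda>z. (eta p l (m + z) - m)\<^sup>2)"
  using square_error_le[OF abs_eta_le[OF assms]] borel_measurable_eta[OF assms]
  by (intro N01_integrable_quadratic[of _ "8 * m\<^sup>2" 2]) auto

lemma integrable_risk_prox:
  assumes "0 \<le> p" "0 \<le> l"
  shows "integrable N01 (\<lambda>z. (prox p l (m + z) - m)\<^sup>2)"
  using square_error_le[OF is_prox_abs_le[OF assms is_prox_prox[OF assms]]] borel_measurable_prox[OF assms]
  by (intro N01_integrable_quadratic[of _ "8 * m\<^sup>2" 2]) auto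

lemma risk_nonneg: "0 \<le> risk p l m"
  by (simp add: risk_def)

lemma risk_le:
  assumes "0 \<le> p" "0 \<le> l"
  shows "risk p l m \<le> 8 * m\<^sup>2 + 2"
proof -
  have "risk p l m \<le> (\<integral>z. 8 * m\<^sup>2 + 2 * z\<^sup>2 \<partial>N01)"
    unfolding risk_def using N01_moments
    by (intro integral_mono integrable_risk assms square_error_le abs_eta_le) auto
  also have "\<dots> = 8 * m\<^sup>2 + 2"
    using N01_moments N01.prob_space by simp
  finally show ?thesis .
qed

lemma N01_integral_minus:
  fixes f :: "real \<Rightarrow> real"
  assumes [measurable]: "f \<in> borel_measurable borel"
  shows "(\<integral>z. f (- z) \<partial>N01) = (\<integral>z. f z \<partial>N01)"
  using lborel_integral_real_affine[of "-1" "\<lambda>z. std_normal_density z * f z" 0]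
  by (simp add: integral_density std_normal_density_def)

lemma risk_minus:
  assumes "0 \<le> p" "0 \<le> l"
  shows "risk p l (- m) = risk p l m"
proof -
  have [measurable]: "eta p l \<in> borel_measurable borel"
    by (rule borel_measurable_eta[OF assms])
  have "(eta p l (- m + - z) - - m)\<^sup>2 = (eta p l (m + z) - m)\<^sup>2" for z
    using eta_minus[of p l "m + z"] by (simp add: power2_eq_square algebra_simps)
  then show ?thesis
    unfolding risk_def using N01_integral_minus[of "\<lambda>z. (eta p l (- m + z) - - m)\<^sup>2"] by simp
qed

text \<open>Stein's identity E[Z f(Z)] = E[f'(Z)] for f(z) = \<open>min (m + z) t\<close>, whose
  derivative is the indicator of z < t - m.\<close>

lemma N01_stein_min:
  "(\<integral>z. z * min (m + z) t \<partial>N01) = N01.prob {..<t - m}"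
proof -
  define b where "b = t - m"
  define c where "c = 1 / sqrt (2 * pi)"
  have dens: "std_normal_density z = c * exp (- z\<^sup>2 / 2)" for z
    by (simp add: std_normal_density_def c_def)
  \<comment> \<open>\<open>F\<close> is an antiderivative of \<open>f\<close> and vanishes at
    \<open>b\<close> and at minus infinity, so there is no boundary term.\<close>
  define F where "F z = - (b - z) * std_normal_density z" for z
  define f where "f z = (z * (b - z) + 1) * std_normal_density z" for z
  have int1: "integrable N01 (\<lambda>z. z * (b - z) + 1)"
  proof -
    have "(\<lambda>z. z * (b - z) + 1) = (\<lambda>z. b * z - z\<^sup>2 + (1::real))"
      by (auto simp: power2_eq_square algebra_simps)
    then show ?thesis using N01_moments by simp
  qed
  then have int2: "integrable N01 (\<lambda>z. indicator {..<b} z *\<^sub>R (z * (b - z) + 1))"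
    by (rule integrable_mult_indicator[rotated]) simp
  have "(LBINT z=-\<infinity>..ereal b. f z) = 0 - 0"
  proof (rule interval_integral_FTC_integrable)
    show "(F has_vector_derivative f x) (at x)" for x
      unfolding F_def f_def dens
      unfolding has_real_derivative_iff_has_vector_derivative[symmetric]
      by (auto intro!: derivative_eq_intros simp: algebra_simps power2_eq_square)
    show "isCont f x" for x
      unfolding f_def dens by (intro continuous_intros) auto
    have "integrable lborel (\<lambda>z. std_normal_density z *\<^sub>R (indicator {..<b} z *\<^sub>R (z * (b - z) + 1)))"
      using int2 by (subst (asm) integrable_density) auto
    then show "set_integrable lborel (einterval (-\<infinity>) (ereal b)) f"
      unfolding set_integrable_def einterval_eq f_def by (simp add: mult_ac)
    show "((F \<circ> real_of_ereal) \<longlongrightarrow> 0) (at_right (- \<infinity>))"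
      unfolding ereal_tendsto_simps F_def dens by real_asymp
    show "((F \<circ> real_of_ereal) \<longlongrightarrow> 0) (at_left (ereal b))"
    proof -
      have "isCont F b" unfolding F_def dens by (intro continuous_intros) auto
      then have "(F \<longlongrightarrow> F b) (at_left b)" by (auto simp: isCont_def filterlim_at_split)
      then show ?thesis unfolding ereal_tendsto_simps by (simp add: F_def)
    qed
  qed auto
  then have zero: "(\<integral>z. indicator {..<b} z *\<^sub>R (z * (b - z) + 1) \<partial>N01) = 0"
    by (subst integral_density)
       (auto simp: interval_lebesgue_integral_def set_lebesgue_integral_def f_def mult_ac einterval_eq)
  have "z * min (m + z) t = t * z - indicator {..<b} z *\<^sub>R (z * (b - z) + 1) + indicator {..<b} z" for z
    by (auto simp: b_def min_def indicator_def algebra_simps)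
  then have "(\<integral>z. z * min (m + z) t \<partial>N01)
      = (\<integral>z. t * z - indicator {..<b} z *\<^sub>R (z * (b - z) + 1) + indicator {..<b} z \<partial>N01)"
    by simp
  also have "\<dots> = t * 0 - 0 + N01.prob {..<b}"
    using int2 zero N01_moments by (subst Bochner_Integration.integral_add; simp)+
  finally show ?thesis by (simp add: b_def)
qed

text \<open>
  Let \<open>t\<close> be the end of the dead zone of \<open>prox p l\<close>. Beyond \<open>t\<close> the residual \<open>u - prox p l u\<close> is
  nonincreasing, so pairing it with the noise \<open>z\<close> gives at most what the truncation of the
  identity at \<open>t\<close> gives, and the latter is computed by Gaussian integration by parts.
\<close>
lemma risk_ge_of_prox_pos:
  assumes p: "0 \<le> p" "p \<le> 1" and l: "0 \<le> l" and pos: "0 < prox p l m"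
  obtains t where "0 \<le> t" "t \<le> m" "\<forall>u\<in>{0..m}. prox p l u = 0 \<longrightarrow> u \<le> t"
    "1 + (\<integral>z. (m + z)\<^sup>2 * indicator {-m..<t - m} z - 2 * indicator {..<t - m} z \<partial>N01) \<le> risk p l m"
proof -
  let ?g = "prox p l"
  define S where "S = {u \<in> {0..m}. ?g u = 0}"
  define t where "t = Sup S"
  \<comment> \<open>The bias at zero noise. Replacing the bias by a constant is free, since a
    constant times \<open>z\<close> integrates to zero.\<close>
  define c where "c = m - ?g m"
  have "0 < m"
    using pos prox_nonpos[OF p(1) l, of m] by (cases "0 < m") auto
  have S: "0 \<in> S" "bdd_above S"
    using \<open>0 < m\<close> prox_zero[OF p(1) l] by (auto simp: S_def)
  have t_upper: "u \<le> t" if "0 \<le> u" "u \<le> m" "?g u = 0" for u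
    unfolding t_def using that S by (intro cSup_upper) (auto simp: S_def)
  have "0 \<le> t" using t_upper[of 0] prox_zero[OF p(1) l] \<open>0 < m\<close> by auto
  have "t \<le> m" unfolding t_def using S by (intro cSup_least) (auto simp: S_def)
  have zero_below: "?g u = 0" if "0 \<le> u" "u < t" for u
  proof -
    obtain v where "v \<in> S" "u < v"
      using less_cSupD[of S u] S(1) \<open>u < t\<close> unfolding t_def by (metis empty_iff)
    then show ?thesis
      using prox_mono[OF p(1) l, of u v] prox_bounds[OF p(1) l \<open>0 \<le> u\<close>] by (auto simp: S_def)
  qed
  have c_le_residual: "c \<le> u - ?g u" if "0 < ?g u" "u \<le> m" for u
    unfolding c_def using prox_residual_antimono[OF p l that] .
  \<comment> \<open>Each \<open>u\<close> strictly between \<open>t\<close> and \<open>m\<close> has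
    a positive image, hence \<open>c \<le> u - prox p l u \<le> u\<close>; then \<open>u\<close>
    decreases to \<open>t\<close>.\<close>
  have "c \<le> t"
  proof (cases "t = m")
    case True
    then show ?thesis using pos by (simp add: c_def)
  next
    case False
    show ?thesis
    proof (rule dense_ge_bounded)
      show "t < m" using False \<open>t \<le> m\<close> by simp
      fix u assume u: "t < u" "u < m"
      then have "0 < ?g u"
        using t_upper[of u] prox_bounds[OF p(1) l, of u] \<open>0 \<le> t\<close> by fastforce
      then show "c \<le> u" using c_le_residual[of u] u by auto
    qed
  qed
  \<comment> \<open>With the bias \<open>h\<close>, the squared error is z^2 - 2zh + h^2. The
    product zh is bounded by z(c - t + min u t), and h^2 is kept only inside the dead zone, where h
    = u.\<close>
  have pointwise: "z\<^sup>2 - 2 * (c - t) * z - 2 * (z * min (m + z) t) + (m + z)\<^sup>2 * indicator {-m..<t - m} z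
      \<le> (?g (m + z) - m)\<^sup>2" for z
  proof -
    define u where "u = m + z"
    define h where "h = u - ?g u"
    have "z * (h - (c - t) - min u t) \<le> 0"
    proof (cases "t \<le> u")
      case True
      have "z * (h - c) \<le> 0"
      proof (cases "0 \<le> z")
        case True
        then have "h \<le> c"
          unfolding h_def c_def u_def by (intro prox_residual_antimono p l pos) auto
        with True show ?thesis by (simp add: mult_nonneg_nonpos)
      next
        case z: False
        have "0 \<le> ?g u" using prox_bounds[OF p(1) l, of u] \<open>0 \<le> t\<close> True by simp
        then have "c \<le> h"
          using c_le_residual[of u] z \<open>c \<le> t\<close> True by (cases "?g u = 0") (auto simp: h_def u_def)
        with z show ?thesis by (simp add: mult_nonpos_nonneg)
      qed
      with True show ?thesis by (simp add: algebra_simps)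
    next
      case False
      then have "z < 0" using \<open>t \<le> m\<close> by (simp add: u_def)
      moreover have "?g u \<le> 0"
        using zero_below[of u] prox_nonpos[OF p(1) l, of u] False by (cases "0 \<le> u") auto
      ultimately show ?thesis
        using False \<open>c \<le> t\<close> by (intro mult_nonpos_nonneg) (auto simp: h_def)
    qed
    moreover have "u\<^sup>2 * indicator {-m..<t - m} z \<le> h\<^sup>2"
      using zero_below[of u] by (auto simp: indicator_def h_def u_def)
    moreover have "(?g u - m)\<^sup>2 = z\<^sup>2 - 2 * (z * h) + h\<^sup>2"
      by (simp add: h_def u_def power2_eq_square algebra_simps)
    ultimately show ?thesis by (simp add: u_def algebra_simps)
  qed
  have int_min: "integrable N01 (\<lambda>z. z * min (m + z) t)"
  proof (rule N01_integrable_quadratic[of _ "(\<bar>m\<bar> + \<bar>t\<bar>)\<^sup>2" 2])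
    fix z :: real
    have "\<bar>min (m + z) t\<bar> \<le> (\<bar>m\<bar> + \<bar>t\<bar>) + \<bar>z\<bar>" by auto
    then have "\<bar>z * min (m + z) t\<bar> \<le> \<bar>z\<bar> * ((\<bar>m\<bar> + \<bar>t\<bar>) + \<bar>z\<bar>)"
      unfolding abs_mult by (rule mult_left_mono) simp
    also have "\<dots> \<le> (\<bar>m\<bar> + \<bar>t\<bar>)\<^sup>2 + 2 * z\<^sup>2"
    proof -
      have "2 * (\<bar>z\<bar> * (\<bar>m\<bar> + \<bar>t\<bar>)) \<le> z\<^sup>2 + (\<bar>m\<bar> + \<bar>t\<bar>)\<^sup>2"
        using sum_squares_bound[of "\<bar>z\<bar>" "\<bar>m\<bar> + \<bar>t\<bar>"] by (simp add: mult_ac)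
      moreover have "\<bar>z\<bar> * \<bar>z\<bar> = z\<^sup>2" by (simp add: power2_eq_square)
      ultimately show ?thesis unfolding distrib_left using zero_le_power2[of "\<bar>m\<bar> + \<bar>t\<bar>"] zero_le_power2[of z] by linarith
    qed
    finally show "\<bar>z * min (m + z) t\<bar> \<le> (\<bar>m\<bar> + \<bar>t\<bar>)\<^sup>2 + 2 * z\<^sup>2" .
  qed simp
  have int_sq: "integrable N01 (\<lambda>z. (m + z)\<^sup>2 * indicator {-m..<t - m} z)"
    using \<open>0 \<le> t\<close>
    by (intro N01_integrable_quadratic[of _ "t\<^sup>2" 0]) (auto simp: indicator_def intro!: power_mono)
  have "1 + (\<integral>z. (m + z)\<^sup>2 * indicator {-m..<t - m} z - 2 * indicator {..<t - m} z \<partial>N01)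
      = (\<integral>z. z\<^sup>2 - 2 * (c - t) * z - 2 * (z * min (m + z) t) + (m + z)\<^sup>2 * indicator {-m..<t - m} z \<partial>N01)"
    using int_min int_sq N01_moments N01_stein_min[of m t] by simp
  also have "\<dots> \<le> risk p l m"
    unfolding risk_eq_prox[OF p(1) l]
    using int_min int_sq N01_moments
    by (intro integral_mono integrable_risk_prox p l pointwise) simp_all
  finally show thesis using that \<open>0 \<le> t\<close> \<open>t \<le> m\<close> t_upper by simp
qed

section \<open>Lower bounds for far signals and for the zero signal\<close>

lemma N01_prob_atMost_le:
  assumes "0 < x"
  shows "N01.prob {..<- x} \<le> 1 / x\<^sup>2"
proof -
  have "N01.prob {..<- x} = (\<integral>z. indicator {..<- x} z \<partial>N01)" by simp
  also have "\<dots> \<le> (\<integral>z. z\<^sup>2 / x\<^sup>2 \<partial>N01)"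
  proof (intro integral_mono)
    fix z
    show "indicator {..<- x} z \<le> z\<^sup>2 / x\<^sup>2"
    proof (cases "z < - x")
      case True
      then have "x\<^sup>2 \<le> z\<^sup>2" using assms abs_le_square_iff[of x z] by simp
      with True assms show ?thesis by simp
    qed simp
  qed (use N01_moments in auto)
  also have "\<dots> = 1 / x\<^sup>2" using N01_moments by simp
  finally show ?thesis .
qed

text \<open>In the dead zone the term (m + z)^2 outweighs the loss 2 once the observation is at
  least 2, so only observations below 2 leave an uncompensated loss.\<close>

lemma risk_ge_tail:
  assumes p: "0 \<le> p" "p \<le> 1" and l: "0 \<le> l" and pos: "0 < prox p l m"
  shows "1 - 2 * N01.prob {..<2 - m} \<le> risk p l m"
proof -
  obtain t where t: "0 \<le> t" "t \<le> m" "\<forall>u\<in>{0..m}. prox p l u = 0 \<longrightarrow> u \<le> t"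
    "1 + (\<integral>z. (m + z)\<^sup>2 * indicator {-m..<t - m} z - 2 * indicator {..<t - m} z \<partial>N01) \<le> risk p l m"
    by (rule risk_ge_of_prox_pos[OF assms]) (rule that)
  have int_sq: "integrable N01 (\<lambda>z. (m + z)\<^sup>2 * indicator {-m..<t - m} z)"
    using t(1) by (intro N01_integrable_quadratic[of _ "t\<^sup>2" 0]) (auto simp: indicator_def intro!: power_mono)
  have "(\<integral>z. - 2 * indicator {..<2 - m} z \<partial>N01)
     \<le> (\<integral>z. (m + z)\<^sup>2 * indicator {-m..<t - m} z - 2 * indicator {..<t - m} z \<partial>N01)"
  proof (intro integral_mono)
    fix z
    have "2 \<le> (m + z)\<^sup>2" if "2 \<le> m + z"
      using power_mono[OF that, of 2] by simp
    then show "- 2 * indicator {..<2 - m} z \<le>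
       (m + z)\<^sup>2 * indicator {-m..<t - m} z - 2 * indicator {..<t - m} z"
      by (auto split: split_indicator)
  qed (use int_sq in auto)
  with t(4) show ?thesis by simp
qed

text \<open>Compared with \<open>risk_ge_tail\<close>, observations in [2,3) are now certainly in
  the dead zone and leave a surplus of at least 4 - 2.\<close>

lemma risk_ge_dead_zone:
  assumes p: "0 \<le> p" "p \<le> 1" and l: "0 \<le> l" and pos: "0 < prox p l m"
    and "3 \<le> m" "prox p l 3 = 0"
  shows "1 + 2 * N01.prob {2 - m..<3 - m} - 2 * N01.prob {..<2 - m} \<le> risk p l m"
proof -
  obtain t where t: "0 \<le> t" "t \<le> m" "\<forall>u\<in>{0..m}. prox p l u = 0 \<longrightarrow> u \<le> t"
    "1 + (\<integral>z. (m + z)\<^sup>2 * indicator {-m..<t - m} z - 2 * indicator {..<t - m} z \<partial>N01) \<le> risk p l m"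
    by (rule risk_ge_of_prox_pos[OF p l pos]) (rule that)
  have "3 \<le> t" using t(3) assms(5,6) by simp
  have int_sq: "integrable N01 (\<lambda>z. (m + z)\<^sup>2 * indicator {-m..<t - m} z)"
    using t(1) by (intro N01_integrable_quadratic[of _ "t\<^sup>2" 0]) (auto simp: indicator_def intro!: power_mono)
  have "(\<integral>z. 2 * indicator {2 - m..<3 - m} z - 2 * indicator {..<2 - m} z \<partial>N01)
     \<le> (\<integral>z. (m + z)\<^sup>2 * indicator {-m..<t - m} z - 2 * indicator {..<t - m} z \<partial>N01)"
  proof (intro integral_mono)
    fix z
    have "4 \<le> (m + z)\<^sup>2" if "2 \<le> m + z"
      using power_mono[OF that, of 2] by simp
    then show "2 * indicator {2 - m..<3 - m} z - 2 * indicator {..<2 - m} z \<le>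
       (m + z)\<^sup>2 * indicator {-m..<t - m} z - 2 * indicator {..<t - m} z"
      using \<open>3 \<le> t\<close> by (auto split: split_indicator)
  qed (use int_sq in auto)
  with t(4) show ?thesis by simp
qed

text \<open>By monotonicity the observations in [m - 2, m - 1) are mapped to 0 as well, each with
  error m^2.\<close>

lemma risk_ge_prox_zero:
  assumes p: "0 \<le> p" "0 \<le> l" and m: "2 \<le> m" "prox p l m = 0"
  shows "m\<^sup>2 * N01.prob {-2..<-1} \<le> risk p l m"
proof -
  have "m\<^sup>2 * N01.prob {-2..<-1} = (\<integral>z. m\<^sup>2 * indicator {-2..<-1} z \<partial>N01)" by simp
  also have "\<dots> \<le> risk p l m"
    unfolding risk_eq_prox[OF p]
  proof (intro integral_mono integrable_risk_prox p)
    fix z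
    have "prox p l (m + z) = 0" if "z \<in> {-2..<-1}"
      using prox_mono[OF p, of "m + z" m] prox_bounds[OF p, of "m + z"] m that by auto
    then show "m\<^sup>2 * indicator {-2..<-1} z \<le> (prox p l (m + z) - m)\<^sup>2"
      by (auto simp: indicator_def)
  qed auto
  finally show ?thesis .
qed

text \<open>The bias beyond 3 does not exceed its value at 3, which is below 3, so an observation of
  at least 4 keeps at least 1.\<close>

lemma risk_zero_ge:
  assumes p: "0 \<le> p" "p \<le> 1" and l: "0 \<le> l" and pos: "0 < prox p l 3"
  shows "N01.prob {4..<5} \<le> risk p l 0"
proof -
  have "N01.prob {4..<5} = (\<integral>z. indicator {4..<5} z \<partial>N01)" by simp
  also have "\<dots> \<le> (\<integral>z. (prox p l (0 + z) - 0)\<^sup>2 \<partial>N01)"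
  proof (intro integral_mono integrable_risk_prox p l)
    fix z :: real
    have "1 \<le> prox p l z" if "z \<in> {4..<5}"
      using prox_residual_antimono[OF p l pos, of z] that pos by auto
    then show "indicator {4..<5} z \<le> (prox p l (0 + z) - 0)\<^sup>2"
      using one_le_power[of "prox p l z" 2] by (auto simp: indicator_def)
  qed auto
  finally show ?thesis unfolding risk_eq_prox[OF p(1) l] .
qed

section \<open>Tilting the Gaussian measure\<close>

lemma normal_density_shift:
  "std_normal_density (u - m) = std_normal_density u * exp (m * u - m\<^sup>2 / 2)"
  by (simp add: std_normal_density_def flip: exp_add) (simp add: power2_eq_square field_simps)

text \<open>The Cameron-Martin formula: the shift \<open>m\<close> becomes an exponential weight
  that is smooth in \<open>m\<close>, even when \<open>f\<close> jumps.\<close>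

lemma N01_integral_shift:
  fixes f :: "real \<Rightarrow> real"
  assumes [measurable]: "f \<in> borel_measurable borel"
  shows "(\<integral>z. f (m + z) \<partial>N01) = (\<integral>u. f u * exp (m * u - m\<^sup>2 / 2) \<partial>N01)"
  using lborel_integral_real_affine[of 1 "\<lambda>u. std_normal_density (u - m) * f u" m]
  by (simp add: integral_density normal_density_shift mult_ac)

lemma N01_integrable_shift:
  fixes f :: "real \<Rightarrow> real"
  assumes [measurable]: "f \<in> borel_measurable borel" and "integrable N01 (\<lambda>z. f (m + z))"
  shows "integrable N01 (\<lambda>u. f u * exp (m * u - m\<^sup>2 / 2))"
proof -
  have "integrable lborel (\<lambda>z. std_normal_density (m + 1 * z - m) * f (m + 1 * z))"
    using assms(2) by (subst (asm) integrable_density) auto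
  then have "integrable lborel (\<lambda>u. std_normal_density (u - m) * f u)"
    by (subst (asm) lborel_integrable_real_affine_iff) auto
  then show ?thesis
    by (subst integrable_density) (auto simp: normal_density_shift mult_ac)
qed

text \<open>Shifting by one multiplies the density below -1 by at most exp(-3/2), which is below
  1/3. Any factor above 2 would do for \<open>N01_gap\<close>.\<close>

lemma N01_tail_shift:
  assumes "x \<le> -1"
  shows "3 * N01.prob {..<x - 1} \<le> N01.prob {..<x}"
proof -
  have "N01.prob {..<x - 1} = (\<integral>z. indicator {..<x - 1} z \<partial>N01)" by simp
  also have "\<dots> = (\<integral>z. indicator {..<x} (1 + z) \<partial>N01)"
    by (intro Bochner_Integration.integral_cong) (auto split: split_indicator)
  also have "\<dots> = (\<integral>u. indicator {..<x} u * exp (u - 1 / 2) \<partial>N01)"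
    by (subst N01_integral_shift) auto
  also have "\<dots> \<le> (\<integral>u. indicator {..<x} u / 3 \<partial>N01)"
  proof (rule integral_mono')
    fix u
    have "exp (u - 1 / 2) \<le> 1 / 3" if "u < x"
    proof -
      have "3 \<le> exp (3 / 2 :: real)"
        using exp_lower_Taylor_quadratic[of "3 / 2"] by (simp add: power2_eq_square)
      moreover have "exp (u - 1 / 2) \<le> exp (- (3 / 2))" using that assms by simp
      ultimately show ?thesis
        unfolding exp_minus using le_imp_inverse_le[of 3 "exp (3 / 2 :: real)"] by simp
    qed
    then show "indicator {..<x} u * exp (u - 1 / 2) \<le> indicator {..<x} u / 3"
      by (auto split: split_indicator)
  qed auto
  also have "\<dots> = N01.prob {..<x} / 3" by simp
  finally show ?thesis by simp
qed

text \<open>This makes the bound of \<open>risk_ge_dead_zone\<close> strictly larger than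
  one.\<close>

lemma N01_gap:
  assumes "4 \<le> m"
  shows "N01.prob {..<2 - m} < N01.prob {2 - m..<3 - m}"
proof -
  have "N01.prob {..<3 - m} = N01.prob {..<2 - m} + N01.prob {2 - m..<3 - m}"
    using N01.finite_measure_Union[of "{..<2 - m}" "{2 - m..<3 - m}"]
    by (simp add: ivl_disj_un ivl_disj_int)
  moreover have "0 < N01.prob {2 - m..<3 - m}" by (rule N01_pos) simp
  ultimately show ?thesis using N01_tail_shift[of "3 - m"] assms by auto
qed

subsection \<open>Regularity of the risk and hard thresholding\<close>

lemma N01_integrable_exp_abs: "integrable N01 (\<lambda>u. exp (k * \<bar>u\<bar>))"
proof -
  have int: "integrable N01 (\<lambda>u. exp (c * u))" for c
  proof -
    have "integrable N01 (\<lambda>u. exp (c\<^sup>2 / 2) * (1 * exp (c * u - c\<^sup>2 / 2)))"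
      by (intro integrable_mult_right N01_integrable_shift) simp_all
    then show ?thesis by (simp flip: exp_add)
  qed
  show ?thesis
  proof (rule Bochner_Integration.integrable_bound)
    show "integrable N01 (\<lambda>u. exp (k * u) + exp (- k * u))"
      by (intro Bochner_Integration.integrable_add int)
    show "AE u in N01. norm (exp (k * \<bar>u\<bar>)) \<le> norm (exp (k * u) + exp (- k * u))"
    proof (rule AE_I2)
      fix u :: real
      have "exp (k * \<bar>u\<bar>) \<le> exp (k * u) + exp (- k * u)" by (cases "0 \<le> u") auto
      then show "norm (exp (k * \<bar>u\<bar>)) \<le> norm (exp (k * u) + exp (- k * u))"
        using abs_ge_self[of "exp (k * u) + exp (- k * u)"] by (simp only: real_norm_def abs_exp_cancel)
    qed
  qed simp
qed

text \<open>Mean value theorem in the shift. With s = \<bar>u\<bar> + M the polynomial factor of the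
  derivative is at most 2s + s^3, and 29 = 2 + 27 comes from s \<le> exp s and (s/3)^3 \<le> exp
  s.\<close>

lemma tilted_square_lipschitz:
  fixes y u M m m' :: real
  assumes "\<bar>y\<bar> \<le> \<bar>u\<bar>" "m \<in> {0..M}" "m' \<in> {0..M}"
  shows "\<bar>(y - m)\<^sup>2 * exp (m * u - m\<^sup>2 / 2) - (y - m')\<^sup>2 * exp (m' * u - m'\<^sup>2 / 2)\<bar>
    \<le> 29 * exp M * exp ((M + 1) * \<bar>u\<bar>) * \<bar>m - m'\<bar>"
proof -
  define D where "D c = (- 2 * (y - c) + (y - c)\<^sup>2 * (u - c)) * exp (c * u - c\<^sup>2 / 2)" for c
  have "norm ((y - m)\<^sup>2 * exp (m * u - m\<^sup>2 / 2) - (y - m')\<^sup>2 * exp (m' * u - m'\<^sup>2 / 2))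
      \<le> (29 * exp M * exp ((M + 1) * \<bar>u\<bar>)) * norm (m - m')"
  proof (rule field_differentiable_bound[of "{0..M}" "\<lambda>c. (y - c)\<^sup>2 * exp (c * u - c\<^sup>2 / 2)" D])
    fix c assume c: "c \<in> {0..M}"
    show "((\<lambda>c. (y - c)\<^sup>2 * exp (c * u - c\<^sup>2 / 2)) has_real_derivative D c) (at c within {0..M})"
      unfolding D_def
      by (auto intro!: derivative_eq_intros simp: algebra_simps power2_eq_square)
    define s where "s = \<bar>u\<bar> + M"
    have s: "\<bar>y - c\<bar> \<le> s" "\<bar>u - c\<bar> \<le> s" "0 \<le> s" using c assms by (auto simp: s_def)
    have "s \<le> exp s" using exp_ge_add_one_self[of s] by linarith
    have "(s / 3)^3 \<le> exp (s / 3) ^ 3"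
      using exp_ge_add_one_self[of "s / 3"] s by (intro power_mono) linarith+
    then have "s^3 \<le> 27 * exp s"
      using exp_of_nat_mult[of 3 "s / 3"] by (simp add: power_divide)
    have abs_terms: "\<bar>- 2 * (y - c)\<bar> = 2 * \<bar>y - c\<bar>"
      "\<bar>(y - c)\<^sup>2 * (u - c)\<bar> = \<bar>y - c\<bar>\<^sup>2 * \<bar>u - c\<bar>"
      by (simp_all only: abs_mult abs_neg_numeral abs_power2 power2_abs)
    have "\<bar>- 2 * (y - c) + (y - c)\<^sup>2 * (u - c)\<bar> \<le> 2 * \<bar>y - c\<bar> + \<bar>y - c\<bar>\<^sup>2 * \<bar>u - c\<bar>"
      using abs_triangle_ineq[of "- 2 * (y - c)" "(y - c)\<^sup>2 * (u - c)"]
      unfolding abs_terms .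
    also have "\<dots> \<le> 2 * s + s\<^sup>2 * s"
      by (intro add_mono mult_left_mono mult_mono power_mono s zero_le_power abs_ge_zero) simp
    also have "\<dots> \<le> 29 * exp s"
      using \<open>s \<le> exp s\<close> \<open>s^3 \<le> 27 * exp s\<close> by (simp add: power2_eq_square power3_eq_cube)
    finally have 1: "\<bar>- 2 * (y - c) + (y - c)\<^sup>2 * (u - c)\<bar> \<le> 29 * exp s" .
    have "c * u \<le> M * \<bar>u\<bar>"
      using c mult_left_mono[OF abs_ge_self[of u], of c] mult_right_mono[of c M "\<bar>u\<bar>"] by auto
    then have "c * u - c\<^sup>2 / 2 \<le> M * \<bar>u\<bar>"
      using zero_le_power2[of c] by linarith
    then have 2: "exp (c * u - c\<^sup>2 / 2) \<le> exp (M * \<bar>u\<bar>)" by simp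
    have "\<bar>D c\<bar> \<le> 29 * exp s * exp (M * \<bar>u\<bar>)"
      unfolding D_def abs_mult using 1 2 by (intro mult_mono) auto
    also have "\<dots> = 29 * exp M * exp ((M + 1) * \<bar>u\<bar>)"
      by (simp add: s_def algebra_simps flip: exp_add)
    finally show "norm (D c) \<le> 29 * exp M * exp ((M + 1) * \<bar>u\<bar>)" by simp
  qed (use assms in auto)
  then show ?thesis by simp
qed

text \<open>After tilting, \<open>eta\<close> enters only through its value at \<open>u\<close>, and
  \<bar>eta\<bar> \<le> \<bar>u\<bar> is all that is used of it; this is why \<open>L\<close> serves
  all \<open>p\<close> and \<open>l\<close> at once.\<close>

lemma risk_lipschitz:
  obtains L where "0 \<le> L"
    "\<And>p l m m'. 0 \<le> p \<Longrightarrow> 0 \<le> l \<Longrightarrow> m \<in> {0..M} \<Longrightarrow> m' \<in> {0..M} \<Longrightarrow>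
      \<bar>risk p l m - risk p l m'\<bar> \<le> L * \<bar>m - m'\<bar>"
proof
  let ?B = "\<lambda>u. 29 * exp M * exp ((M + 1) * \<bar>u\<bar>)"
  show "0 \<le> (\<integral>u. ?B u \<partial>N01)" by (rule Bochner_Integration.integral_nonneg) simp
  fix p l m m' :: real assume p: "0 \<le> p" "0 \<le> l" and m: "m \<in> {0..M}" "m' \<in> {0..M}"
  have [measurable]: "eta p l \<in> borel_measurable borel" by (rule borel_measurable_eta[OF p])
  let ?psi = "\<lambda>c u. (eta p l u - c)\<^sup>2 * exp (c * u - c\<^sup>2 / 2)"
  have risk_eq: "risk p l c = (\<integral>u. ?psi c u \<partial>N01)" for c
    unfolding risk_def using N01_integral_shift[of "\<lambda>u. (eta p l u - c)\<^sup>2" c] by simp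
  have int: "integrable N01 (?psi c)" for c
    by (rule N01_integrable_shift[of "\<lambda>u. (eta p l u - c)\<^sup>2"]) (simp_all add: integrable_risk[OF p])
  have int_B: "integrable N01 (\<lambda>u. ?B u * \<bar>m - m'\<bar>)"
    by (intro integrable_mult_left integrable_mult_right N01_integrable_exp_abs)
  have int_diff: "integrable N01 (\<lambda>u. \<bar>?psi m u - ?psi m' u\<bar>)"
    by (intro integrable_abs Bochner_Integration.integrable_diff int)
  have "\<bar>risk p l m - risk p l m'\<bar> = \<bar>\<integral>u. ?psi m u - ?psi m' u \<partial>N01\<bar>"
    unfolding risk_eq using Bochner_Integration.integral_diff[OF int int, of m m'] by (simp only:)
  also have "\<dots> \<le> (\<integral>u. \<bar>?psi m u - ?psi m' u\<bar> \<partial>N01)"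
    by (rule integral_abs_bound)
  also have "\<dots> \<le> (\<integral>u. ?B u * \<bar>m - m'\<bar> \<partial>N01)"
    by (intro integral_mono int_B int_diff tilted_square_lipschitz abs_eta_le p m)
  also have "\<dots> = (\<integral>u. ?B u \<partial>N01) * \<bar>m - m'\<bar>" by (rule integral_mult_left_zero)
  finally show "\<bar>risk p l m - risk p l m'\<bar> \<le> (\<integral>u. ?B u \<partial>N01) * \<bar>m - m'\<bar>" .
qed

section \<open>Limits of the hard thresholding risk\<close>

lemma hard_risk_tendsto_at_top:
  assumes "0 < a"
  shows "(risk 0 (a\<^sup>2 / 2) \<longlongrightarrow> 1) at_top"
proof -
  have [measurable]: "eta 0 (a\<^sup>2 / 2) \<in> borel_measurable borel" by (rule borel_measurable_eta) auto
  have "((\<lambda>m. \<integral>z. (eta 0 (a\<^sup>2 / 2) (m + z) - m)\<^sup>2 \<partial>N01) \<longlongrightarrow> (\<integral>z. z\<^sup>2 \<partial>N01)) at_top"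
  proof (rule integral_dominated_convergence_at_top[where w = "\<lambda>z. 2 * a\<^sup>2 + 2 * z\<^sup>2"])
    show "integrable N01 (\<lambda>z. 2 * a\<^sup>2 + 2 * z\<^sup>2)" using N01_moments by simp
    show "AE z in N01. ((\<lambda>m. (eta 0 (a\<^sup>2 / 2) (m + z) - m)\<^sup>2) \<longlongrightarrow> z\<^sup>2) at_top"
    proof (rule AE_I2)
      fix z
      have "eventually (\<lambda>m. (eta 0 (a\<^sup>2 / 2) (m + z) - m)\<^sup>2 = z\<^sup>2) at_top"
        using eventually_gt_at_top[of "a - z"]
      proof eventually_elim
        case (elim m)
        then have "a < \<bar>m + z\<bar>" by linarith
        then show ?case by (simp add: eta_hard[OF assms])
      qed
      then show "((\<lambda>m. (eta 0 (a\<^sup>2 / 2) (m + z) - m)\<^sup>2) \<longlongrightarrow> z\<^sup>2) at_top"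
        by (rule tendsto_eventually)
    qed
    show "\<forall>\<^sub>F m in at_top. AE z in N01. norm ((eta 0 (a\<^sup>2 / 2) (m + z) - m)\<^sup>2) \<le> 2 * a\<^sup>2 + 2 * z\<^sup>2"
    proof (intro always_eventually allI AE_I2)
      fix m z :: real
      \<comment> \<open>The bound of \<open>square_error_le\<close> grows with \<open>m\<close> and
        cannot dominate. Hard thresholding errs by \<bar>z\<bar>, or by \<bar>m\<bar> when the
        observation is within \<open>a\<close> of 0, and then \<bar>m\<bar> \<le> a +
        \<bar>z\<bar>.\<close>
      have "\<bar>eta 0 (a\<^sup>2 / 2) (m + z) - m\<bar> \<le> a + \<bar>z\<bar>"
      proof (cases "a < \<bar>m + z\<bar>")
        case True
        then show ?thesis using assms by (simp add: eta_hard)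
      next
        case False
        then have "\<bar>m\<bar> \<le> a + \<bar>z\<bar>" by linarith
        with False show ?thesis by (simp add: eta_hard[OF assms])
      qed
      then have "(eta 0 (a\<^sup>2 / 2) (m + z) - m)\<^sup>2 \<le> (a + \<bar>z\<bar>)\<^sup>2"
        using power_mono[of "\<bar>eta 0 (a\<^sup>2 / 2) (m + z) - m\<bar>" _ 2] by simp
      also have "\<dots> \<le> (a + \<bar>z\<bar>)\<^sup>2 + (a - \<bar>z\<bar>)\<^sup>2" by simp
      also have "\<dots> = 2 * a\<^sup>2 + 2 * z\<^sup>2" by (simp add: power2_eq_square algebra_simps abs_mult_self_eq)
      finally show "norm ((eta 0 (a\<^sup>2 / 2) (m + z) - m)\<^sup>2) \<le> 2 * a\<^sup>2 + 2 * z\<^sup>2" by simp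
    qed
  qed auto
  then show ?thesis by (simp add: risk_def[abs_def] N01_moments)
qed

lemma hard_risk_zero_tendsto: "((\<lambda>a. risk 0 (a\<^sup>2 / 2) 0) \<longlongrightarrow> 0) at_top"
proof -
  have "((\<lambda>a. \<integral>z. (if a < \<bar>z\<bar> then z\<^sup>2 else 0) \<partial>N01) \<longlongrightarrow> (\<integral>z. 0 \<partial>N01)) at_top"
  proof (rule integral_dominated_convergence_at_top[where w = "\<lambda>z. z\<^sup>2"])
    show "AE z in N01. ((\<lambda>a. if a < \<bar>z\<bar> then z\<^sup>2 else 0) \<longlongrightarrow> 0) at_top"
    proof (rule AE_I2)
      fix z :: real
      have "eventually (\<lambda>a. (if a < \<bar>z\<bar> then z\<^sup>2 else 0) = 0) at_top"
        using eventually_ge_at_top[of "\<bar>z\<bar>"] by eventually_elim simp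
      then show "((\<lambda>a. if a < \<bar>z\<bar> then z\<^sup>2 else 0) \<longlongrightarrow> 0) at_top"
        by (rule tendsto_eventually)
    qed
    show "integrable N01 (\<lambda>z. z\<^sup>2)" by (rule N01_moments)
    show "\<forall>\<^sub>F a in at_top. AE z in N01. norm (if a < \<bar>z\<bar> then z\<^sup>2 else 0) \<le> z\<^sup>2"
      by (intro always_eventually allI AE_I2) simp
  qed simp_all
  then have lim: "((\<lambda>a. \<integral>z. (if a < \<bar>z\<bar> then z\<^sup>2 else 0) \<partial>N01) \<longlongrightarrow> 0) at_top"
    by simp
  have "eventually (\<lambda>a. (\<integral>z. (if a < \<bar>z\<bar> then z\<^sup>2 else 0) \<partial>N01) = risk 0 (a\<^sup>2 / 2) 0) at_top"
    using eventually_gt_at_top[of 0]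
  proof eventually_elim
    case (elim a)
    show ?case
      unfolding risk_def eta_hard[OF elim] by (rule Bochner_Integration.integral_cong) simp_all
  qed
  from tendsto_cong[OF this] lim show ?thesis by (rule iffD1)
qed

subsection \<open>Isolated sign changes\<close>

text \<open>
  Let \<open>\<theta>\<close> range over an interval. Transversality in \<open>\<theta>\<close> makes the set of parameters having
  a zero in an interval of length \<open>1 / n\<close> an interval of length \<open>O(1 / n)\<close>, so the number of
  cells of a \<open>1 / n\<close>-grid that contain a zero is integrable in \<open>\<theta>\<close> uniformly in \<open>n\<close>.
  This is the argument behind the Banach indicatrix.
\<close>
lemma finite_zeros_transversal:
  fixes H :: "real \<Rightarrow> real \<Rightarrow> real"
  assumes ab: "a < b" and \<theta>1: "0 < \<theta>1" and c: "0 < c" and L: "0 \<le> L"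
    and lip: "\<And>\<theta> m m'. \<theta> \<in> {0..\<theta>1} \<Longrightarrow> m \<in> {a..b} \<Longrightarrow> m' \<in> {a..b} \<Longrightarrow>
      \<bar>H \<theta> m - H \<theta> m'\<bar> \<le> L * \<bar>m - m'\<bar>"
    and transv: "\<And>\<theta> \<theta>' m. 0 \<le> \<theta> \<Longrightarrow> \<theta> < \<theta>' \<Longrightarrow> \<theta>' \<le> \<theta>1 \<Longrightarrow> m \<in> {a..b} \<Longrightarrow> H \<theta> m = 0 \<Longrightarrow>
      c * (\<theta>' - \<theta>) \<le> H \<theta>' m"
  shows "\<exists>\<theta>\<in>{0..\<theta>1}. finite {m \<in> {a..b}. H \<theta> m = 0}"
proof (rule ccontr)
  assume neg: "\<not> ?thesis"
  define K where "K n m = nat \<lfloor>(m - a) * real n\<rfloor>" for n :: nat and m :: real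
  define Y where "Y n k = {\<theta> \<in> {0..\<theta>1}. \<exists>m\<in>{a..b}. H \<theta> m = 0 \<and> K n m = k}" for n k
  \<comment> \<open>An interval around \<open>Y n k\<close>, which itself need not be measurable.
    Its length is the bound \<open>diam\<close> on differences within \<open>Y n k\<close>.\<close>
  define J where "J n k = (if Y n k = {} then {} else {Inf (Y n k)..Inf (Y n k) + L / (c * real n)})" for n k
  define N where "N n \<theta> = (\<Sum>k\<le>K n b. indicator (J n k) \<theta> :: ennreal)" for n \<theta>
  have K_diff: "\<bar>m - m'\<bar> \<le> 1 / real n" if "0 < n" "m \<in> {a..b}" "m' \<in> {a..b}" "K n m = K n m'" for n m m'
  proof -
    have "0 \<le> (m - a) * real n" "0 \<le> (m' - a) * real n" using that by auto
    then have "\<lfloor>(m - a) * real n\<rfloor> = \<lfloor>(m' - a) * real n\<rfloor>"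
      using that(4) by (simp add: K_def eq_nat_nat_iff)
    then have "\<bar>(m - a) * real n - (m' - a) * real n\<bar> \<le> 1" by linarith
    then have "\<bar>m - m'\<bar> * real n \<le> 1"
      by (simp add: abs_mult flip: left_diff_distrib)
    then show ?thesis using \<open>0 < n\<close> by (simp add: field_simps)
  qed
  have diam: "\<theta>' - \<theta> \<le> L / (c * real n)" if "0 < n" "\<theta> \<in> Y n k" "\<theta>' \<in> Y n k" for n k \<theta> \<theta>'
  proof (cases "\<theta> < \<theta>'")
    case True
    obtain m m' where m: "m \<in> {a..b}" "H \<theta> m = 0" "K n m = k" "m' \<in> {a..b}" "H \<theta>' m' = 0" "K n m' = k"
      using \<open>\<theta> \<in> Y n k\<close> \<open>\<theta>' \<in> Y n k\<close> unfolding Y_def by auto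
    have th: "0 \<le> \<theta>" "\<theta>' \<le> \<theta>1" "\<theta>' \<in> {0..\<theta>1}" using that True by (auto simp: Y_def)
    have "c * (\<theta>' - \<theta>) \<le> H \<theta>' m" using transv[OF th(1) True th(2) m(1,2)] .
    also have "\<dots> \<le> L * \<bar>m - m'\<bar>" using lip[OF th(3) m(1,4)] m(5) by simp
    also have "\<dots> \<le> L * (1 / real n)"
      using K_diff[OF \<open>0 < n\<close> m(1,4)] m(3,6) L by (intro mult_left_mono) auto
    finally show ?thesis using c \<open>0 < n\<close> by (simp add: field_simps)
  next
    case False
    moreover have "0 \<le> L / (c * real n)" using c L by simp
    ultimately show ?thesis by linarith
  qed
  have Y_J: "Y n k \<subseteq> J n k" if "0 < n" for n k
  proof
    fix \<theta> assume \<theta>: "\<theta> \<in> Y n k"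
    have "bdd_below (Y n k)" unfolding Y_def by (rule bdd_belowI[of _ 0]) auto
    then have "Inf (Y n k) \<le> \<theta>" using \<theta> by (intro cInf_lower)
    moreover have "\<theta> - L / (c * real n) \<le> Inf (Y n k)"
      using \<theta> diam[OF that _ \<theta>] by (intro cInf_greatest) (auto simp: algebra_simps)
    ultimately show "\<theta> \<in> J n k" using \<theta> by (auto simp: J_def)
  qed
  have J_borel [measurable]: "J n k \<in> sets borel" for n k by (simp add: J_def)
  have int_N: "(\<integral>\<^sup>+ \<theta>. N n \<theta> \<partial>lborel) \<le> ennreal (L / c * (b - a + 1))" if "0 < n" for n
  proof -
    have "(\<integral>\<^sup>+ \<theta>. N n \<theta> \<partial>lborel) = (\<Sum>k\<le>K n b. emeasure lborel (J n k))"
      unfolding N_def by (subst nn_integral_sum) (simp_all add: J_borel)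
    also have "\<dots> \<le> (\<Sum>k\<le>K n b. ennreal (L / (c * real n)))"
      using c L by (intro sum_mono) (auto simp: J_def)
    also have "\<dots> = ennreal (real (Suc (K n b)) * (L / (c * real n)))"
      unfolding ennreal_mult'[OF of_nat_0_le_iff]
      by (simp only: sum_constant card_atMost ennreal_of_nat_eq_real_of_nat)
    also have "\<dots> \<le> ennreal (L / c * (b - a + 1))"
    proof (rule ennreal_leI)
      have "real (K n b) \<le> (b - a) * real n" using ab by (simp add: K_def)
      \<comment> \<open>The summand 1 in \<open>b - a + 1\<close> pays for the last, possibly
        partial, cell.\<close>
      then have "real (Suc (K n b)) \<le> (b - a + 1) * real n"
        using that by (simp add: algebra_simps)
      then have "real (Suc (K n b)) * (L / (c * real n)) \<le> ((b - a + 1) * real n) * (L / (c * real n))"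
        using c L by (intro mult_right_mono) auto
      also have "\<dots> = L / c * (b - a + 1)" using c that by (simp add: field_simps)
      finally show "real (Suc (K n b)) * (L / (c * real n)) \<le> L / c * (b - a + 1)" .
    qed
    finally show ?thesis .
  qed
  \<comment> \<open>Any \<open>j\<close> distinct zeros lie in distinct cells once 1/n is below
    their mutual distances.\<close>
  have N_ge: "\<forall>\<^sub>F n in sequentially. of_nat j \<le> N n \<theta>" if \<theta>: "\<theta> \<in> {0..\<theta>1}" for j \<theta>
  proof -
    have "infinite {m \<in> {a..b}. H \<theta> m = 0}" using neg \<theta> by blast
    then obtain S where S: "finite S" "card S = j" "S \<subseteq> {m \<in> {a..b}. H \<theta> m = 0}"
      using infinite_arbitrarily_large by blast
    have sep: "\<forall>\<^sub>F n in sequentially. x \<noteq> y \<longrightarrow> K n x \<noteq> K n y" if "x \<in> S" "y \<in> S" for x y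
    proof (cases "x = y")
      case False
      obtain n0 where n0: "1 / \<bar>x - y\<bar> < real n0" using reals_Archimedean2 by blast
      show ?thesis
        using eventually_ge_at_top[of "max 1 n0"]
      proof eventually_elim
        case (elim n)
        have "1 / \<bar>x - y\<bar> < real n" using n0 elim by (auto intro: less_le_trans)
        then have "1 / real n < \<bar>x - y\<bar>" using False elim by (simp add: field_simps)
        then show ?case using K_diff[of n x y] elim that S by fastforce
      qed
    qed simp
    have "\<forall>\<^sub>F n in sequentially. \<forall>x\<in>S. \<forall>y\<in>S. x \<noteq> y \<longrightarrow> K n x \<noteq> K n y"
      using sep S(1) by (intro eventually_ball_finite ballI) auto
    then show ?thesis
      using eventually_gt_at_top[of 0]
    proof eventually_elim
      case (elim n)
      have "inj_on (K n) S" using elim(1) by (auto simp: inj_on_def)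
      then have "of_nat j = (\<Sum>k\<in>K n ` S. 1 :: ennreal)"
        using S by (simp add: card_image)
      also have "\<dots> \<le> (\<Sum>k\<in>K n ` S. indicator (J n k) \<theta>)"
      proof (rule sum_mono)
        fix k assume "k \<in> K n ` S"
        then obtain x where "x \<in> S" "k = K n x" by blast
        moreover have "x \<in> {a..b}" "H \<theta> x = 0" using S(3) \<open>x \<in> S\<close> by auto
        ultimately have "\<theta> \<in> Y n k" using \<theta> unfolding Y_def by blast
        then have "\<theta> \<in> J n k" using Y_J elim(2) by blast
        then show "1 \<le> (indicator (J n k) \<theta> :: ennreal)" by simp
      qed
      also have "\<dots> \<le> N n \<theta>"
        unfolding N_def
      proof (rule sum_mono2)
        show "K n ` S \<subseteq> {..K n b}"
          using S by (auto simp: K_def intro!: nat_mono floor_mono mult_right_mono)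
      qed auto
      finally show ?case .
    qed
  qed
  \<comment> \<open>Fatou's lemma bounds \<open>j * \<theta>1\<close> by the uniform bound on the
    integrals of \<open>N n\<close>; this \<open>j\<close> violates it.\<close>
  obtain j :: nat where j: "L / c * (b - a + 1) / \<theta>1 < real j" using reals_Archimedean2 by blast
  have "ennreal (real j * \<theta>1) = (\<integral>\<^sup>+ \<theta>. of_nat j * indicator {0..\<theta>1} \<theta> \<partial>lborel)"
    using \<theta>1 by (subst nn_integral_cmult_indicator)
      (auto simp: ennreal_mult'' ennreal_of_nat_eq_real_of_nat)
  also have "\<dots> \<le> (\<integral>\<^sup>+ \<theta>. liminf (\<lambda>n. N n \<theta>) \<partial>lborel)"
    using N_ge by (intro nn_integral_mono) (auto split: split_indicator intro!: Liminf_bounded)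
  also have "\<dots> \<le> liminf (\<lambda>n. \<integral>\<^sup>+ \<theta>. N n \<theta> \<partial>lborel)"
    by (rule nn_integral_liminf) (simp add: N_def)
  also have "\<dots> \<le> limsup (\<lambda>n. \<integral>\<^sup>+ \<theta>. N n \<theta> \<partial>lborel)"
    by (rule Liminf_le_Limsup) simp
  also have "\<dots> \<le> ennreal (L / c * (b - a + 1))"
    by (intro Limsup_bounded eventually_mono[OF eventually_gt_at_top[of "0::nat"]]) (rule int_N)
  finally have "real j * \<theta>1 \<le> L / c * (b - a + 1)"
    using L c ab by (subst (asm) ennreal_le_iff) auto
  moreover have "L / c * (b - a + 1) < real j * \<theta>1"
    using j by (simp only: pos_divide_less_eq[OF \<theta>1])
  ultimately show False by simp
qed

text \<open>The supremum \<open>z\<close> of the points with \<open>f < 0\<close> is an isolated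
  zero. To its right \<open>f\<close> is nonnegative, hence positive near \<open>z\<close>. A
  nonnegative value shortly before \<open>z\<close> would be followed by a negative one, and the
  intermediate value theorem would give another zero next to \<open>z\<close>.\<close>

lemma sign_change_of_finite_zeros:
  fixes f :: "real \<Rightarrow> real"
  assumes "a < b" and cont: "continuous_on {a..b} f" and fa: "f a < 0" and fb: "0 < f b"
    and fin: "finite {m \<in> {a..b}. f m = 0}"
  obtains z d where "0 < d" "a \<le> z - d" "z + d \<le> b" "f z = 0"
    "\<forall>m\<in>{z - d<..<z}. f m < 0" "\<forall>m\<in>{z<..<z + d}. 0 < f m"
proof -
  define S where "S = {m \<in> {a..b}. f m < 0}"
  define z where "z = Sup S"
  have S: "a \<in> S" "bdd_above S" using assms by (auto simp: S_def)
  have z: "a \<le> z" "z \<le> b"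
    unfolding z_def using S by (auto intro: cSup_upper intro!: cSup_least simp: S_def)
  have upper: "m \<le> z" if "m \<in> {a..b}" "f m < 0" for m
    unfolding z_def using S that by (intro cSup_upper) (auto simp: S_def)
  have near: "\<exists>s\<in>S. m < s" if "m < z" for m
    using less_cSupD[of S m] S(1) that unfolding z_def by blast
  have "f z \<le> 0"
  proof (rule ccontr)
    assume "\<not> f z \<le> 0"
    then obtain e where e: "0 < e" "\<And>m. m \<in> {a..b} \<Longrightarrow> dist m z < e \<Longrightarrow> dist (f m) (f z) < f z"
      using cont z unfolding continuous_on_iff by (metis atLeastAtMost_iff not_le)
    obtain s where s: "s \<in> S" "z - e < s" using near[of "z - e"] e by auto
    then have "s \<le> z" using upper by (auto simp: S_def)
    then have "dist (f s) (f z) < f z" using s e(1) by (intro e(2)) (auto simp: S_def dist_real_def)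
    with s show False by (auto simp: S_def dist_real_def)
  qed
  moreover have "0 \<le> f z"
  proof (rule ccontr)
    assume "\<not> 0 \<le> f z"
    then have "z < b" using fb z by (cases "z = b") auto
    obtain e where e: "0 < e" "\<And>m. m \<in> {a..b} \<Longrightarrow> dist m z < e \<Longrightarrow> dist (f m) (f z) < - f z"
      using cont z \<open>\<not> 0 \<le> f z\<close> unfolding continuous_on_iff
      by (metis atLeastAtMost_iff neg_0_less_iff_less not_le)
    define m where "m = min b (z + e / 2)"
    have "m \<in> {a..b}" "dist m z < e" "z < m" using z \<open>z < b\<close> e(1) by (auto simp: m_def dist_real_def)
    then have "f m < 0" using e(2)[of m] by (simp add: dist_real_def)
    with upper \<open>m \<in> {a..b}\<close> \<open>z < m\<close> show False by force
  qed
  ultimately have "f z = 0" by simp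
  then have strict: "a < z" "z < b" using z fa fb by (auto simp: less_le)
  obtain e where e: "0 < e" "\<And>m. m \<in> {a..b} \<Longrightarrow> f m = 0 \<Longrightarrow> m \<noteq> z \<Longrightarrow> e \<le> dist z m"
    using finite_set_avoid[OF fin, of z] by auto
  define d where "d = Min {e, z - a, b - z}"
  have d: "0 < d" "d \<le> e" "a \<le> z - d" "z + d \<le> b" using e(1) strict by (auto simp: d_def)
  have nz: "f m \<noteq> 0" if "z - d < m" "m < z + d" "m \<noteq> z" for m
    using e(2)[of m] that d by (auto simp: dist_real_def)
  show thesis
  proof (rule that[OF d(1,3,4) \<open>f z = 0\<close>]; rule ballI)
    fix m assume "m \<in> {z - d<..<z}"
    then have m: "z - d < m" "m < z" by auto
    show "f m < 0"
    proof (rule ccontr)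
      assume "\<not> f m < 0"
      then have "0 \<le> f m" by simp
      obtain s where s: "s \<in> S" "m < s" using near m by blast
      then have "s \<le> z" using upper by (auto simp: S_def)
      then have "s < z" using s \<open>f z = 0\<close> by (cases "s = z") (auto simp: S_def)
      obtain x where "m \<le> x" "x \<le> s" "f x = 0"
        using IVT2'[of f s 0 m] \<open>0 \<le> f m\<close> s m d z continuous_on_subset[OF cont, of "{m..s}"]
        by (auto simp: S_def)
      then show False using nz[of x] m \<open>s < z\<close> d by auto
    qed
  next
    fix m assume "m \<in> {z<..<z + d}"
    then have m: "z < m" "m < z + d" by auto
    then have "f m \<noteq> 0" using nz d by auto
    moreover have "\<not> f m < 0" using upper[of m] m d z by auto
    ultimately show "0 < f m" by simp
  qed
qed

subsection \<open>State evolution\<close>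

text \<open>Either \<open>m\<close> is mapped to 0 and an event of fixed probability \<kappa> costs
  m^2, or \<open>risk_ge_tail\<close> applies. The summand 1/\<kappa> of the bound makes the first
  cost at least 1, and 2/e makes the Chebyshev tail at most e/2.\<close>

lemma risk_ge_of_far_signal:
  assumes "0 < e"
  obtains M where "0 < M"
    "\<And>p l m. 0 \<le> p \<Longrightarrow> p \<le> 1 \<Longrightarrow> 0 \<le> l \<Longrightarrow> M \<le> m \<Longrightarrow> 1 - e \<le> risk p l m"
proof
  define \<kappa> where "\<kappa> = N01.prob {-2..<-1}"
  have "0 < \<kappa>" unfolding \<kappa>_def by (rule N01_pos) simp
  show "0 < 3 + 2 / e + 1 / \<kappa>" using assms \<open>0 < \<kappa>\<close> by (simp add: add_pos_pos)
  fix p l m :: real assume p: "0 \<le> p" "p \<le> 1" "0 \<le> l" and m: "3 + 2 / e + 1 / \<kappa> \<le> m"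
  have m_ge: "3 \<le> m" "2 / e \<le> m - 2" "1 / \<kappa> \<le> m"
    using m assms \<open>0 < \<kappa>\<close> divide_pos_pos[of 2 e] divide_pos_pos[of 1 \<kappa>] by linarith+
  show "1 - e \<le> risk p l m"
  proof (cases "prox p l m = 0")
    case True
    have "1 \<le> m * \<kappa>" using m_ge(3) \<open>0 < \<kappa>\<close> by (simp add: field_simps)
    also have "\<dots> \<le> m\<^sup>2 * \<kappa>" using m_ge(1) \<open>0 < \<kappa>\<close> by (simp add: power2_eq_square)
    also have "\<dots> \<le> risk p l m"
      unfolding \<kappa>_def using m_ge(1) True p by (intro risk_ge_prox_zero) auto
    finally show ?thesis using assms by simp
  next
    case False
    then have pos: "0 < prox p l m" using prox_bounds(1)[OF p(1,3), of m] m_ge(1) by simp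
    have "N01.prob {..<2 - m} \<le> 1 / (m - 2)\<^sup>2"
      using N01_prob_atMost_le[of "m - 2"] m_ge(1) by simp
    also have "\<dots> \<le> e / 2"
    proof -
      have "2 / e \<le> (m - 2)\<^sup>2"
        using m_ge(1,2) self_le_power[of "m - 2" 2] by linarith
      then show ?thesis using assms m_ge(1) by (simp add: field_simps)
    qed
    finally show ?thesis using risk_ge_tail[OF p pos] by simp
  qed
qed

text \<open>Three cases for an arbitrary estimator: it maps \<open>m\<close> to 0 and the far risk
  is at least 2; its dead zone reaches 3 and the far risk exceeds 1 by 2g; or it keeps observations
  at 3 and pays at the zero signal.\<close>

lemma two_point_risk_barrier:
  assumes \<delta>: "0 < \<delta>" "\<delta> < 1"
  obtains m \<gamma> where "0 < m" "0 < \<gamma>"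
    "\<And>p l. 0 \<le> p \<Longrightarrow> p \<le> 1 \<Longrightarrow> 0 \<le> l \<Longrightarrow> \<delta> + \<gamma> \<le> (1 - \<delta>) * risk p l 0 + \<delta> * risk p l m"
proof -
  define \<kappa> where "\<kappa> = N01.prob {-2..<-1}"
  define \<kappa>' where "\<kappa>' = N01.prob {4..<5}"
  \<comment> \<open>Half the price at the zero signal in the third case. That price, 2e, covers the
    deficit \<delta> e of the far risk and still leaves \<open>\<gamma> \<le> e\<close>.\<close>
  define e where "e = (1 - \<delta>) * \<kappa>' / 2"
  have \<kappa>: "0 < \<kappa>" "0 < \<kappa>'" unfolding \<kappa>_def \<kappa>'_def by (intro N01_pos; simp)+
  have "0 < e" using \<kappa> \<delta> by (simp add: e_def)
  define m where "m = 4 + 2 / \<kappa> + 2 / e"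
  have m_ge: "4 \<le> m" "2 / e \<le> m - 2" "2 / \<kappa> \<le> m"
    using \<kappa>(1) \<open>0 < e\<close> divide_pos_pos[of 2 e] divide_pos_pos[of 2 \<kappa>] unfolding m_def by linarith+
  define g where "g = N01.prob {2 - m..<3 - m} - N01.prob {..<2 - m}"
  have "0 < g" using N01_gap[OF m_ge(1)] by (simp add: g_def)
  define \<gamma> where "\<gamma> = Min {\<delta>, e, 2 * \<delta> * g}"
  have \<gamma>: "0 < \<gamma>" "\<gamma> \<le> \<delta>" "\<gamma> \<le> e" "\<gamma> \<le> 2 * \<delta> * g"
    using \<delta> \<open>0 < e\<close> \<open>0 < g\<close> by (auto simp: \<gamma>_def)
  show thesis
  proof (rule that[of m \<gamma>])
    show "0 < m" "0 < \<gamma>" using m_ge \<gamma> by auto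
    fix p l :: real assume p: "0 \<le> p" "p \<le> 1" "0 \<le> l"
    have r0: "0 \<le> (1 - \<delta>) * risk p l 0" using \<delta> by (simp add: risk_nonneg)
    show "\<delta> + \<gamma> \<le> (1 - \<delta>) * risk p l 0 + \<delta> * risk p l m"
    proof (cases "prox p l m = 0")
      case True
      have "2 \<le> m * \<kappa>" using m_ge(3) \<kappa> by (simp add: field_simps)
      also have "\<dots> \<le> m\<^sup>2 * \<kappa>" using m_ge(1) \<kappa> by (simp add: power2_eq_square)
      also have "\<dots> \<le> risk p l m"
        unfolding \<kappa>_def using m_ge(1) True p by (intro risk_ge_prox_zero) auto
      finally have "\<delta> * 2 \<le> \<delta> * risk p l m" using \<delta> by simp
      with r0 \<gamma> show ?thesis by linarith
    next
      case False
      then have pos: "0 < prox p l m" using prox_bounds(1)[OF p(1,3), of m] m_ge(1) by simp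
      show ?thesis
      proof (cases "prox p l 3 = 0")
        case True
        have "1 + 2 * g \<le> risk p l m"
          using risk_ge_dead_zone[OF p pos _ True] m_ge(1) by (simp add: g_def)
        then have "\<delta> * (1 + 2 * g) \<le> \<delta> * risk p l m" using \<delta> by simp
        with r0 \<gamma> show ?thesis by (simp add: algebra_simps)
      next
        case False
        then have pos3: "0 < prox p l 3" using prox_bounds(1)[OF p(1,3), of 3] by simp
        have "N01.prob {..<2 - m} \<le> 1 / (m - 2)\<^sup>2"
          using N01_prob_atMost_le[of "m - 2"] m_ge(1) by simp
        also have "\<dots> \<le> e / 2"
        proof -
          have "2 / e \<le> (m - 2)\<^sup>2"
            using m_ge(1,2) self_le_power[of "m - 2" 2] by linarith
          then show ?thesis using \<open>0 < e\<close> m_ge(1) by (simp add: field_simps)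
        qed
        finally have "1 - e \<le> risk p l m" using risk_ge_tail[OF p pos] by simp
        then have "\<delta> * (1 - e) \<le> \<delta> * risk p l m" using \<delta> by simp
        then have 1: "\<delta> - \<delta> * e \<le> \<delta> * risk p l m" by (simp add: right_diff_distrib)
        have "(1 - \<delta>) * \<kappa>' \<le> (1 - \<delta>) * risk p l 0"
          unfolding \<kappa>'_def using \<delta> by (intro mult_left_mono risk_zero_ge p pos3) auto
        then have 2: "2 * e \<le> (1 - \<delta>) * risk p l 0" by (simp add: e_def)
        have "\<delta> * e \<le> e" using \<delta> \<open>0 < e\<close> by simp
        with 1 2 \<gamma>(3) show ?thesis by linarith
      qed
    qed
  qed
qed

section \<open>From the state evolution map to the risk at unit noise\<close>

lemma borel_measurable_risk:
  assumes "0 \<le> p" "0 \<le> l"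
  shows "risk p l \<in> borel_measurable borel"
proof -
  have [measurable]: "eta p l \<in> borel_measurable borel" by (rule borel_measurable_eta[OF assms])
  show ?thesis
    unfolding risk_def[abs_def]
    by (rule N01.borel_measurable_lebesgue_integral) measurable
qed

lemma integrable_risk_scaled:
  assumes P: "prob_space P" "sets P = sets borel" "integrable P (\<lambda>x. x\<^sup>2)" and pl: "0 \<le> p" "0 \<le> l"
  shows "integrable P (\<lambda>x. risk p l (x / \<sigma>))"
proof -
  interpret P: prob_space P by fact
  have [measurable]: "risk p l \<in> borel_measurable borel" by (rule borel_measurable_risk[OF pl])
  note [measurable_cong] = P(2)
  show ?thesis
  proof (rule Bochner_Integration.integrable_bound)
    show "integrable P (\<lambda>x. 8 / \<sigma>\<^sup>2 * x\<^sup>2 + 2)"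
      using P(3) by simp
    show "AE x in P. norm (risk p l (x / \<sigma>)) \<le> norm (8 / \<sigma>\<^sup>2 * x\<^sup>2 + 2)"
    proof (rule AE_I2)
      fix x
      show "norm (risk p l (x / \<sigma>)) \<le> norm (8 / \<sigma>\<^sup>2 * x\<^sup>2 + 2)"
        using risk_le[OF pl, of "x / \<sigma>"] by (simp add: risk_nonneg power_divide)
    qed
  qed measurable
qed

lemma mse_scale:
  assumes P: "prob_space P" "sets P = sets borel" "integrable P (\<lambda>x. x\<^sup>2)"
    and pl: "0 \<le> p" "0 \<le> l" and "0 < \<sigma>"
  shows "mse P (l * \<sigma> powr (2 - p)) p \<sigma> = \<sigma>\<^sup>2 * (\<integral>x. risk p l (x / \<sigma>) \<partial>P)"
proof -
  interpret P: prob_space P by fact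
  interpret PN: pair_sigma_finite P N01 ..
  note [measurable_cong] = P(2)
  have [measurable]: "eta p l \<in> borel_measurable borel" by (rule borel_measurable_eta[OF pl])
  define F where "F = (\<lambda>(x, z). (eta p l (x / \<sigma> + z) - x / \<sigma>)\<^sup>2)"
  have [measurable]: "F \<in> borel_measurable (P \<Otimes>\<^sub>M N01)" unfolding F_def by measurable
  have "integrable (P \<Otimes>\<^sub>M N01) F"
  proof (rule PN.Fubini_integrable)
    show "integrable P (\<lambda>x. \<integral>z. norm (F (x, z)) \<partial>N01)"
      using integrable_risk_scaled[OF P pl, of \<sigma>] by (simp add: F_def risk_def)
    show "AE x in P. integrable N01 (\<lambda>z. F (x, z))"
      using integrable_risk[OF pl] by (simp add: F_def)
  qed simp
  then have Fubini: "integral\<^sup>L (P \<Otimes>\<^sub>M N01) F = (\<integral>x. risk p l (x / \<sigma>) \<partial>P)"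
    by (subst PN.integral_fst'[symmetric]) (simp_all add: F_def risk_def)
  have "(eta p (l * \<sigma> powr (2 - p)) (x + \<sigma> * z) - x)\<^sup>2 = \<sigma>\<^sup>2 * F (x, z)" for x z
  proof -
    have arg: "x + \<sigma> * z = \<sigma> * (x / \<sigma> + z)" and x: "x = \<sigma> * (x / \<sigma>)"
      using \<open>0 < \<sigma>\<close> by (simp_all add: distrib_left)
    have "eta p (l * \<sigma> powr (2 - p)) (x + \<sigma> * z) - x = \<sigma> * (eta p l (x / \<sigma> + z) - x / \<sigma>)"
      unfolding arg eta_scale[OF \<open>0 < \<sigma>\<close>] right_diff_distrib using x by simp
    then show ?thesis by (simp add: F_def power_mult_distrib)
  qed
  then have "mse P (l * \<sigma> powr (2 - p)) p \<sigma> = (\<integral>w. \<sigma>\<^sup>2 * F w \<partial>(P \<Otimes>\<^sub>M N01))"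
    unfolding mse_def by (intro Bochner_Integration.integral_cong) auto
  then show ?thesis using Fubini by simp
qed

lemma mse_nonneg: "0 \<le> mse P l p \<sigma>"
  unfolding mse_def by (intro Bochner_Integration.integral_nonneg) auto

lemma Psi_zero: "Psi P \<delta> 0 0 = 0"
proof -
  have "(INF (l, p) \<in> {0..} \<times> {0..1}. mse P l p (sqrt 0)) = 0"
  proof (rule antisym)
    have "bdd_below ((\<lambda>(l, p). mse P l p (sqrt 0)) ` ({0..} \<times> {0..1}))"
      by (rule bdd_belowI[of _ 0]) (auto intro: mse_nonneg)
    moreover have "mse P 0 0 (sqrt 0) = 0"
      by (simp add: mse_def eta_no_penalty case_prod_beta')
    ultimately show "(INF (l, p) \<in> {0..} \<times> {0..1}. mse P l p (sqrt 0)) \<le> 0"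
      using cINF_lower[of "\<lambda>(l, p). mse P l p (sqrt 0)" "{0..} \<times> {0..1}" "(0, 0)"] by simp
    show "0 \<le> (INF (l, p) \<in> {0..} \<times> {0..1}. mse P l p (sqrt 0))"
      by (rule cINF_greatest) (auto intro: mse_nonneg)
  qed
  then show ?thesis by (simp add: Psi_def)
qed

lemma Psi_le:
  assumes P: "prob_space P" "sets P = sets borel" "integrable P (\<lambda>x. x\<^sup>2)"
    and p: "0 \<le> p" "p \<le> 1" "0 \<le> l" and "0 < \<sigma>" "0 < \<delta>"
  shows "Psi P \<delta> 0 (\<sigma>\<^sup>2) \<le> \<sigma>\<^sup>2 / \<delta> * (\<integral>x. risk p l (x / \<sigma>) \<partial>P)"
proof -
  have "bdd_below ((\<lambda>(l, p). mse P l p \<sigma>) ` ({0..} \<times> {0..1}))"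
    by (rule bdd_belowI[of _ 0]) (auto intro: mse_nonneg)
  from cINF_lower[OF this, of "(l * \<sigma> powr (2 - p), p)"]
  have "(INF (l, p) \<in> {0..} \<times> {0..1}. mse P l p \<sigma>) \<le> \<sigma>\<^sup>2 * (\<integral>x. risk p l (x / \<sigma>) \<partial>P)"
    using p mse_scale[OF P p(1,3) \<open>0 < \<sigma>\<close>] by simp
  then show ?thesis
    using assms(7,8) by (simp add: Psi_def divide_right_mono)
qed

lemma Psi_ge:
  assumes P: "prob_space P" "sets P = sets borel" "integrable P (\<lambda>x. x\<^sup>2)"
    and v: "\<And>p l. 0 \<le> p \<Longrightarrow> p \<le> 1 \<Longrightarrow> 0 \<le> l \<Longrightarrow> v \<le> (\<integral>x. risk p l (x / \<sigma>) \<partial>P)"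
    and "0 < \<sigma>" "0 < \<delta>"
  shows "\<sigma>\<^sup>2 / \<delta> * v \<le> Psi P \<delta> 0 (\<sigma>\<^sup>2)"
proof -
  have "\<sigma>\<^sup>2 * v \<le> mse P l p \<sigma>" if "0 \<le> l" "0 \<le> p" "p \<le> 1" for l p
  proof -
    \<comment> \<open>For fixed \<open>p\<close> the rescaling of the penalty weight is a bijection
      of the nonnegative half-line, so a bound over all \<open>t\<close> covers all
      \<open>l\<close>.\<close>
    define t where "t = l * \<sigma> powr (p - 2)"
    have "l = t * \<sigma> powr (2 - p)"
      using \<open>0 < \<sigma>\<close> by (simp add: t_def mult.assoc flip: powr_add)
    moreover have "0 \<le> t" using that by (simp add: t_def)
    ultimately show ?thesis
      using mse_scale[OF P \<open>0 \<le> p\<close> \<open>0 \<le> t\<close> \<open>0 < \<sigma>\<close>] v[of p t] that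
      by (simp add: mult_left_mono)
  qed
  then have "\<sigma>\<^sup>2 * v \<le> (INF (l, p) \<in> {0..} \<times> {0..1}. mse P l p \<sigma>)"
    by (intro cINF_greatest) auto
  then show ?thesis
    using assms(5,6) by (simp add: Psi_def divide_right_mono)
qed

text \<open>Two independent coins: the first selects the far atom \<open>y\<close> with probability
  \<theta>, otherwise the second selects \<open>x\<close> with probability \<open>q\<close>.
  Expectations are thus affine in \<theta> between the two-point law and the atom
  \<open>y\<close>.\<close>

definition three_point :: "real \<Rightarrow> real \<Rightarrow> real \<Rightarrow> real \<Rightarrow> real measure" where
  "three_point \<theta> q x y = distr (measure_pmf (pair_pmf (bernoulli_pmf \<theta>) (bernoulli_pmf q))) borel
     (\<lambda>(b, c). if b then y else if c then x else 0)"

lemma prob_space_three_point: "prob_space (three_point \<theta> q x y)"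
  unfolding three_point_def by (intro measure_pmf.prob_space_distr) simp

lemma sets_three_point [simp, measurable_cong]: "sets (three_point \<theta> q x y) = sets borel"
  by (simp add: three_point_def)

lemma integrable_three_point:
  fixes f :: "real \<Rightarrow> real"
  assumes "f \<in> borel_measurable borel"
  shows "integrable (three_point \<theta> q x y) f"
  unfolding three_point_def
  by (subst integrable_distr_eq) (use assms in \<open>auto intro: integrable_measure_pmf_finite\<close>)

lemma integral_three_point:
  fixes f :: "real \<Rightarrow> real"
  assumes "f \<in> borel_measurable borel" "0 \<le> \<theta>" "\<theta> \<le> 1" "0 \<le> q" "q \<le> 1"
  shows "(\<integral>w. f w \<partial>three_point \<theta> q x y) = \<theta> * f y + (1 - \<theta>) * (q * f x + (1 - q) * f 0)"
proof -
  have "(\<integral>w. f w \<partial>three_point \<theta> q x y) =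
    (\<integral>w. f (case w of (b, c) \<Rightarrow> if b then y else if c then x else 0)
       \<partial>measure_pmf (pair_pmf (bernoulli_pmf \<theta>) (bernoulli_pmf q)))"
    unfolding three_point_def by (subst integral_distr) (use assms in auto)
  also have "\<dots> = (\<Sum>w\<in>UNIV. f (case w of (b, c) \<Rightarrow> if b then y else if c then x else 0) *
      pmf (pair_pmf (bernoulli_pmf \<theta>) (bernoulli_pmf q)) w)"
    by (rule integral_measure_pmf_real) auto
  also have "\<dots> = \<theta> * f y + (1 - \<theta>) * (q * f x + (1 - q) * f 0)"
    using assms by (simp add: UNIV_Times_UNIV[symmetric] UNIV_bool sum.cartesian_product[symmetric]
        pmf_pair algebra_simps del: UNIV_Times_UNIV)
  finally show ?thesis .
qed

lemma three_point_sparse: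
  assumes "0 \<le> \<theta>" "\<theta> \<le> 1" "0 \<le> q" "q \<le> 1" "\<theta> + q \<le> \<epsilon>"
  shows "three_point \<theta> q x y \<in> sparse_dists \<epsilon>"
proof -
  interpret prob_space "three_point \<theta> q x y" by (rule prob_space_three_point)
  have "measure (three_point \<theta> q x y) {w. w \<noteq> 0} = (\<integral>w. indicator {w. w \<noteq> 0} w \<partial>three_point \<theta> q x y)"
    by (simp add: three_point_def)
  also have "\<dots> = \<theta> * indicator {w. w \<noteq> 0} y + (1 - \<theta>) * (q * indicator {w. w \<noteq> 0} x)"
    using assms by (subst integral_three_point) auto
  also have "\<dots> \<le> \<theta> * 1 + 1 * (q * 1)"
    using assms by (intro add_mono mult_mono) (auto simp: indicator_def)
  finally have "measure (three_point \<theta> q x y) {w. w \<noteq> 0} \<le> \<epsilon>" using assms by simp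
  then show ?thesis
    by (simp add: sparse_dists_def prob_space_three_point integrable_three_point)
qed

lemma hard_threshold_small_risk:
  assumes "0 < e"
  obtains a where "0 < a" "risk 0 (a\<^sup>2 / 2) 0 < e"
proof -
  have "\<forall>\<^sub>F a in at_top. 0 < a \<and> risk 0 (a\<^sup>2 / 2) 0 < e"
    using order_tendstoD(2)[OF hard_risk_zero_tendsto assms] eventually_gt_at_top[of 0]
    by eventually_elim simp
  then show thesis using eventually_happens' that by (metis (lifting) trivial_limit_at_top_linorder)
qed

lemma integral_risk_three_point:
  assumes "0 \<le> p" "0 \<le> l" "0 \<le> \<theta>" "\<theta> \<le> 1" "0 \<le> q" "q \<le> 1"
  shows "(\<integral>w. risk p l (w / \<sigma>) \<partial>three_point \<theta> q x y) =
    \<theta> * risk p l (y / \<sigma>) + (1 - \<theta>) * (q * risk p l (x / \<sigma>) + (1 - q) * risk p l 0)"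
proof -
  have [measurable]: "risk p l \<in> borel_measurable borel"
    using assms by (intro borel_measurable_risk)
  show ?thesis using assms by (subst integral_three_point) auto
qed

text \<open>As \<sigma> tends to 0 both scaled atoms go to infinity, where hard thresholding has
  risk 1. The mean risk tends to at most \<theta> + q plus the risk at zero, which a high threshold
  makes smaller than \<delta> - \<theta> - q.\<close>

lemma stable_zero_three_point:
  assumes q: "0 \<le> \<theta>" "0 \<le> q" "\<theta> + q < \<delta>" "\<delta> < 1" and xy: "0 < x" "0 < y"
  shows "stable_fixed_point (Psi (three_point \<theta> q x y) \<delta> 0) 0"
proof -
  let ?P = "three_point \<theta> q x y"
  obtain a where a: "0 < a" "risk 0 (a\<^sup>2 / 2) 0 < \<delta> - \<theta> - q"
    using hard_threshold_small_risk[of "\<delta> - \<theta> - q"] q by auto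
  define r where "r = risk 0 (a\<^sup>2 / 2)"
  have "0 \<le> r 0" by (simp add: r_def risk_nonneg)
  have lim: "((\<lambda>\<sigma>. r (c / \<sigma>)) \<longlongrightarrow> 1) (at_right 0)" if "0 < c" for c
  proof (rule filterlim_compose[of r])
    show "(r \<longlongrightarrow> 1) at_top" unfolding r_def by (rule hard_risk_tendsto_at_top[OF a(1)])
    show "filterlim (\<lambda>\<sigma>. c / \<sigma>) at_top (at_right 0)"
      using filterlim_tendsto_pos_mult_at_top[OF tendsto_const that filterlim_inverse_at_top_right]
      by (simp add: divide_inverse)
  qed
  have "((\<lambda>\<sigma>. \<theta> * r (y / \<sigma>) + (1 - \<theta>) * (q * r (x / \<sigma>) + (1 - q) * r 0))
      \<longlongrightarrow> \<theta> * 1 + (1 - \<theta>) * (q * 1 + (1 - q) * r 0)) (at_right 0)"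
    by (intro tendsto_intros lim xy)
  moreover have "\<theta> * 1 + (1 - \<theta>) * (q * 1 + (1 - q) * r 0) < \<delta>"
  proof -
    have "(1 - q) * r 0 \<le> r 0" "0 \<le> (1 - q) * r 0"
      using q \<open>0 \<le> r 0\<close> by (auto intro: mult_left_le_one_le)
    then have "(1 - \<theta>) * (q * 1 + (1 - q) * r 0) \<le> q + r 0"
      using mult_left_le_one_le[of "q * 1 + (1 - q) * r 0" "1 - \<theta>"] q by simp
    then show ?thesis using a(2) by (simp add: r_def)
  qed
  ultimately have "\<forall>\<^sub>F \<sigma> in at_right 0. \<theta> * r (y / \<sigma>) + (1 - \<theta>) * (q * r (x / \<sigma>) + (1 - q) * r 0) < \<delta>"
    by (rule order_tendstoD(2))
  then obtain b where b: "0 < b"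
    "\<And>\<sigma>. 0 < \<sigma> \<Longrightarrow> \<sigma> < b \<Longrightarrow> \<theta> * r (y / \<sigma>) + (1 - \<theta>) * (q * r (x / \<sigma>) + (1 - q) * r 0) < \<delta>"
    unfolding eventually_at_right[OF zero_less_one] by auto
  have "Psi ?P \<delta> 0 (\<sigma>\<^sup>2) < \<sigma>\<^sup>2" if "0 < \<sigma>" "\<sigma> < b" for \<sigma>
  proof -
    have "Psi ?P \<delta> 0 (\<sigma>\<^sup>2) \<le> \<sigma>\<^sup>2 / \<delta> * (\<integral>w. risk 0 (a\<^sup>2 / 2) (w / \<sigma>) \<partial>?P)"
      using q that by (intro Psi_le prob_space_three_point integrable_three_point) auto
    also have "(\<integral>w. risk 0 (a\<^sup>2 / 2) (w / \<sigma>) \<partial>?P)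
        = \<theta> * r (y / \<sigma>) + (1 - \<theta>) * (q * r (x / \<sigma>) + (1 - q) * r 0)"
      unfolding r_def using q by (intro integral_risk_three_point) auto
    also have "\<sigma>\<^sup>2 / \<delta> * (\<theta> * r (y / \<sigma>) + (1 - \<theta>) * (q * r (x / \<sigma>) + (1 - q) * r 0)) < \<sigma>\<^sup>2 / \<delta> * \<delta>"
      using that q by (intro mult_strict_left_mono b(2)) auto
    also have "\<dots> = \<sigma>\<^sup>2" using q by simp
    finally show ?thesis .
  qed
  then show ?thesis
    using b(1) by (auto simp: stable_fixed_point_def Psi_zero)
qed

lemma cINF_le_cINF_plus:
  fixes f g :: "'a \<Rightarrow> real"
  assumes "A \<noteq> {}" "\<And>w. w \<in> A \<Longrightarrow> 0 \<le> f w" "\<And>w. w \<in> A \<Longrightarrow> f w \<le> g w + e"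
  shows "(INF w\<in>A. f w) \<le> (INF w\<in>A. g w) + e"
proof -
  have "bdd_below (f ` A)" using assms(2) by (rule bdd_belowI2)
  then have "(INF w\<in>A. f w) - e \<le> g w" if "w \<in> A" for w
    using cINF_lower[of f A w] assms(3)[OF that] that by simp
  then have "(INF w\<in>A. f w) - e \<le> (INF w\<in>A. g w)"
    by (intro cINF_greatest assms)
  then show ?thesis by simp
qed

text \<open>
  A second, far away atom of mass \<open>\<theta>\<close> is added to the two-point distribution. As it costs
  about one whatever the thresholding function is, and \<open>\<delta> < 1\<close>, it moves the state evolution
  map transversally, so that for some \<open>\<theta>\<close> the map crosses the diagonal at an isolated point.
\<close>
lemma exists_extra_stable_fixed_point:
  assumes \<delta>: "0 < \<delta>" "\<delta> < 1" and q: "0 \<le> q" "q < \<delta>" "q < \<epsilon>" "\<epsilon> \<le> 1" and "0 < ms" "0 < \<gamma>"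
    and barrier: "\<And>p l. 0 \<le> p \<Longrightarrow> p \<le> 1 \<Longrightarrow> 0 \<le> l \<Longrightarrow> \<delta> + \<gamma> \<le> (1 - q) * risk p l 0 + q * risk p l ms"
  shows "\<exists>P\<in>sparse_dists \<epsilon>. stable_fixed_point (Psi P \<delta> 0) 0 \<and>
    (\<exists>\<sigma>f>0. stable_fixed_point (Psi P \<delta> 0) \<sigma>f)"
proof -
  obtain a where a: "0 < a" "risk 0 (a\<^sup>2 / 2) 0 < \<delta>"
    using hard_threshold_small_risk[OF \<delta>(1)] by auto
  define r where "r = risk 0 (a\<^sup>2 / 2)"
  have r0: "0 \<le> r 0" "r 0 < \<delta>" using a(2) by (simp_all add: r_def risk_nonneg)
  obtain L0 where L0: "0 \<le> L0" "\<And>p l m m'. 0 \<le> p \<Longrightarrow> 0 \<le> l \<Longrightarrow> m \<in> {0..ms} \<Longrightarrow> m' \<in> {0..ms} \<Longrightarrow>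
      \<bar>risk p l m - risk p l m'\<bar> \<le> L0 * \<bar>m - m'\<bar>"
    using risk_lipschitz[of ms] by blast
  \<comment> \<open>Small enough that the Lipschitz bound carries \<open>r 0 < \<delta>\<close> over
    to \<open>r ml < \<delta>\<close>. This is the end of the range with large \<sigma>, where the
    map lies below the diagonal.\<close>
  define ml where "ml = min (ms / 2) ((\<delta> - r 0) / (2 * (L0 + 1)))"
  have ml: "0 < ml" "ml < ms" using \<open>0 < ms\<close> r0 L0(1) by (auto simp: ml_def)
  define \<rho> where "\<rho> = q * r ml + (1 - q) * r 0"
  have "\<rho> < \<delta>"
  proof -
    have "ml \<le> (\<delta> - r 0) / (2 * (L0 + 1))" by (simp add: ml_def)
    then have "ml * (2 * (L0 + 1)) \<le> \<delta> - r 0" using L0(1) by (simp add: pos_le_divide_eq)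
    then have "L0 * ml < \<delta> - r 0"
      using ml(1) mult_nonneg_nonneg[OF L0(1), of ml] by (simp add: algebra_simps)
    moreover have "r ml \<le> r 0 + L0 * ml"
      using L0(2)[of 0 "a\<^sup>2 / 2" ml 0] ml by (simp add: r_def)
    ultimately have "r ml < \<delta>" by simp
    then have "q * r ml \<le> q * \<delta>" "(1 - q) * r 0 < (1 - q) * \<delta>"
      using q \<delta> r0 by (auto intro!: mult_left_mono)
    then show ?thesis unfolding \<rho>_def by (simp add: algebra_simps)
  qed
  obtain M where M: "0 < M"
    "\<And>p l m. 0 \<le> p \<Longrightarrow> p \<le> 1 \<Longrightarrow> 0 \<le> l \<Longrightarrow> M \<le> m \<Longrightarrow> 1 - (1 - \<delta>) / 2 \<le> risk p l m"
    using risk_ge_of_far_signal[of "(1 - \<delta>) / 2"] \<delta> by auto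
  \<comment> \<open>The ratio of the two atoms. It makes \<open>K * m \<ge> M\<close> on the whole
    range from \<open>ml\<close> upwards, so a single far atom stays far for every \<sigma>
    considered.\<close>
  define K where "K = max 1 (M / ml)"
  have "1 \<le> K" by (simp add: K_def)
  have far: "\<delta> + (1 - \<delta>) / 2 \<le> risk p l (K * m)" if "0 \<le> p" "p \<le> 1" "0 \<le> l" "ml \<le> m" for p l m
  proof -
    have "M = M / ml * ml" using ml by simp
    also have "\<dots> \<le> K * m" using that ml M(1) by (intro mult_mono) (auto simp: K_def)
    finally have "1 - (1 - \<delta>) / 2 \<le> risk p l (K * m)" using M(2) that by blast
    then show ?thesis by (simp add: field_simps)
  qed
  obtain L where L: "0 \<le> L" "\<And>p l m m'. 0 \<le> p \<Longrightarrow> 0 \<le> l \<Longrightarrow> m \<in> {0..K * ms} \<Longrightarrow> m' \<in> {0..K * ms} \<Longrightarrow>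
      \<bar>risk p l m - risk p l m'\<bar> \<le> L * \<bar>m - m'\<bar>"
    using risk_lipschitz[of "K * ms"] by blast
  define A :: "(real \<times> real) set" where "A = {0..} \<times> {0..1}"
  define h where "h \<theta> m = (\<lambda>(l, p). \<theta> * risk p l (K * m) + (1 - \<theta>) * (q * risk p l m + (1 - q) * risk p l 0))"
    for \<theta> m
  define H where "H \<theta> m = (INF w\<in>A. h \<theta> m w) - \<delta>" for \<theta> m
  have "A \<noteq> {}" by (auto simp: A_def)
  have h_nonneg: "0 \<le> h \<theta> m w" if "\<theta> \<in> {0..1}" for \<theta> m w
    using that q \<delta> by (cases w) (auto simp: h_def risk_nonneg)
  have bdd: "bdd_below (h \<theta> m ` A)" if "\<theta> \<in> {0..1}" for \<theta> m
    by (rule bdd_belowI2[of A 0], rule h_nonneg[OF that])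
  have H_le: "H \<theta> m \<le> h \<theta> m w - \<delta>" if "\<theta> \<in> {0..1}" "w \<in> A" for \<theta> m w
    using cINF_lower[OF bdd[OF that(1)] that(2)] by (simp add: H_def)
  have H_ge: "v - \<delta> \<le> H \<theta> m" if "\<And>w. w \<in> A \<Longrightarrow> v \<le> h \<theta> m w" for \<theta> m v
    using cINF_greatest[OF \<open>A \<noteq> {}\<close> that] by (simp add: H_def)
  have h_lip: "h \<theta> m w \<le> h \<theta> m' w + L * (K + 1) * \<bar>m - m'\<bar>"
    if "\<theta> \<in> {0..1}" "m \<in> {ml..ms}" "m' \<in> {ml..ms}" "w \<in> A" for \<theta> m m' w
  proof -
    obtain l p where w: "w = (l, p)" "0 \<le> l" "0 \<le> p" using \<open>w \<in> A\<close> by (auto simp: A_def)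
    have "ms \<le> K * ms" using \<open>1 \<le> K\<close> \<open>0 < ms\<close> by simp
    then have "m \<le> K * ms" "m' \<le> K * ms"
      using that(2,3) by (meson atLeastAtMost_iff order.trans)+
    then have in_range: "K * m \<in> {0..K * ms}" "K * m' \<in> {0..K * ms}" "m \<in> {0..K * ms}" "m' \<in> {0..K * ms}"
      using that \<open>1 \<le> K\<close> ml by auto
    define D where "D = L * \<bar>m - m'\<bar>"
    have "0 \<le> D" using L(1) by (simp add: D_def)
    have "\<bar>K * m - K * m'\<bar> = K * \<bar>m - m'\<bar>"
      using \<open>1 \<le> K\<close> by (simp add: abs_mult flip: right_diff_distrib)
    then have 1: "risk p l (K * m) - risk p l (K * m') \<le> K * D"
      using L(2)[OF w(3,2) in_range(1,2)] by (simp add: D_def mult_ac)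
    have 2: "risk p l m - risk p l m' \<le> D"
      using L(2)[OF w(3,2) in_range(3,4)] by (simp add: D_def)
    have "\<theta> * (risk p l (K * m) - risk p l (K * m')) \<le> 1 * (K * D)"
      using that(1) \<open>1 \<le> K\<close> \<open>0 \<le> D\<close>
      by (intro order.trans[OF mult_left_mono[OF 1]] mult_right_mono) auto
    moreover have "(1 - \<theta>) * q * (risk p l m - risk p l m') \<le> 1 * D"
      using that(1) q \<delta> \<open>0 \<le> D\<close>
      by (intro order.trans[OF mult_left_mono[OF 2]] mult_right_mono) (auto intro: mult_le_one)
    ultimately show ?thesis by (simp add: h_def w D_def algebra_simps)
  qed
  have H_lip: "\<bar>H \<theta> m - H \<theta> m'\<bar> \<le> L * (K + 1) * \<bar>m - m'\<bar>"
    if "\<theta> \<in> {0..1}" "m \<in> {ml..ms}" "m' \<in> {ml..ms}" for \<theta> m m'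
  proof -
    have "(INF w\<in>A. h \<theta> m w) \<le> (INF w\<in>A. h \<theta> m' w) + L * (K + 1) * \<bar>m - m'\<bar>"
      using that by (intro cINF_le_cINF_plus \<open>A \<noteq> {}\<close> h_nonneg h_lip) auto
    moreover have "(INF w\<in>A. h \<theta> m' w) \<le> (INF w\<in>A. h \<theta> m w) + L * (K + 1) * \<bar>m' - m\<bar>"
      using that by (intro cINF_le_cINF_plus \<open>A \<noteq> {}\<close> h_nonneg h_lip) auto
    ultimately show ?thesis by (simp add: H_def abs_minus_commute)
  qed
  \<comment> \<open>At a zero each estimator has mean risk \<theta> v + (1 - \<theta>) u \<ge>
    \<delta>, with v \<ge> \<delta> + c. If u \<le> \<delta>, the slope v - u is at least c; if u >
    \<delta>, the excess at \<theta>' is already at least \<theta>' c. The bound holds for each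
    estimator, so no minimizing pair has to exist.\<close>
  have transv: "(1 - \<delta>) / 2 * (\<theta>' - \<theta>) \<le> H \<theta>' m"
    if "0 \<le> \<theta>" "\<theta> < \<theta>'" "\<theta>' \<le> 1" "m \<in> {ml..ms}" "H \<theta> m = 0" for \<theta> \<theta>' m
  proof -
    have "\<delta> + (1 - \<delta>) / 2 * (\<theta>' - \<theta>) \<le> h \<theta>' m w" if "w \<in> A" for w
    proof -
      obtain l p where w: "w = (l, p)" "0 \<le> l" "0 \<le> p" "p \<le> 1" using \<open>w \<in> A\<close> by (auto simp: A_def)
      define u where "u = q * risk p l m + (1 - q) * risk p l 0"
      define v where "v = risk p l (K * m)"
      define c where "c = (1 - \<delta>) / 2"
      have "0 < c" using \<delta> by (simp add: c_def)
      have v: "\<delta> + c \<le> v" unfolding v_def c_def using far w \<open>m \<in> {ml..ms}\<close> by auto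
      have ge: "\<delta> \<le> \<theta> * v + (1 - \<theta>) * u"
        using H_le[of \<theta> w m] that \<open>0 \<le> \<theta>\<close> \<open>\<theta> < \<theta>'\<close> \<open>\<theta>' \<le> 1\<close> \<open>H \<theta> m = 0\<close> by (simp add: h_def w u_def v_def)
      have "\<delta> + c * (\<theta>' - \<theta>) \<le> \<theta>' * v + (1 - \<theta>') * u"
      proof (cases "u \<le> \<delta>")
        case True
        then have "(\<theta>' - \<theta>) * c \<le> (\<theta>' - \<theta>) * (v - u)"
          using v \<open>\<theta> < \<theta>'\<close> by (intro mult_left_mono) auto
        with ge show ?thesis by (simp add: algebra_simps)
      next
        case False
        have "\<theta>' * c \<le> \<theta>' * (v - \<delta>)" "0 \<le> (1 - \<theta>') * (u - \<delta>)" "0 \<le> \<theta> * c"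
          using v False \<open>0 \<le> \<theta>\<close> \<open>\<theta> < \<theta>'\<close> \<open>\<theta>' \<le> 1\<close> \<open>0 < c\<close> by (auto intro!: mult_left_mono)
        then show ?thesis by (simp add: algebra_simps)
      qed
      then show ?thesis by (simp add: h_def w u_def v_def c_def)
    qed
    from H_ge[OF this] show ?thesis by simp
  qed
  \<comment> \<open>The entries keep, in order, \<theta> a probability, the law \<epsilon>-sparse,
    zero stable, and the map below the diagonal at \<open>ml\<close>.\<close>
  define t where "t = Min {1 / 2, (\<epsilon> - q) / 2, (\<delta> - q) / 2, (\<delta> - \<rho>) / (2 * (r (K * ml) + 1))}"
  have rK: "0 \<le> r (K * ml)" by (simp add: r_def risk_nonneg)
  have t: "0 < t" "t \<le> 1" "t + q < \<epsilon>" "t + q < \<delta>" "t * (r (K * ml) + 1) < \<delta> - \<rho>"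
  proof -
    show "0 < t" using q \<open>\<rho> < \<delta>\<close> rK by (auto simp: t_def)
    have "t \<le> (\<epsilon> - q) / 2" "t \<le> (\<delta> - q) / 2" "t \<le> 1 / 2"
      "t \<le> (\<delta> - \<rho>) / (2 * (r (K * ml) + 1))" unfolding t_def by (rule Min_le; simp)+
    then show "t \<le> 1" "t + q < \<epsilon>" "t + q < \<delta>" using q by auto
    have "t * (2 * (r (K * ml) + 1)) \<le> \<delta> - \<rho>"
      using \<open>t \<le> (\<delta> - \<rho>) / (2 * (r (K * ml) + 1))\<close> rK by (simp add: pos_le_divide_eq)
    then have "2 * (t * (r (K * ml) + 1)) \<le> \<delta> - \<rho>" by (simp only: mult.left_commute)
    then show "t * (r (K * ml) + 1) < \<delta> - \<rho>" using \<open>\<rho> < \<delta>\<close> by linarith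
  qed
  have "\<exists>\<theta>\<in>{0..t}. finite {m \<in> {ml..ms}. H \<theta> m = 0}"
    using ml t L(1) \<open>1 \<le> K\<close> \<delta>
    by (intro finite_zeros_transversal[where L = "L * (K + 1)" and c = "(1 - \<delta>) / 2"] H_lip transv) auto
  then obtain \<theta> where \<theta>: "0 \<le> \<theta>" "\<theta> \<le> t" and fin: "finite {m \<in> {ml..ms}. H \<theta> m = 0}"
    by auto
  have \<theta>1: "\<theta> \<in> {0..1}" using \<theta> t by auto
  have cont: "continuous_on {ml..ms} (H \<theta>)"
    using H_lip[OF \<theta>1] L(1) \<open>1 \<le> K\<close>
    by (intro lipschitz_on_continuous_on[of "L * (K + 1)"] lipschitz_onI) (auto simp: dist_real_def)
  have low: "H \<theta> ml < 0"
  proof -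
    have "(a\<^sup>2 / 2, 0) \<in> A" by (simp add: A_def)
    then have "H \<theta> ml \<le> \<theta> * r (K * ml) + (1 - \<theta>) * \<rho> - \<delta>"
      using H_le[OF \<theta>1, of "(a\<^sup>2 / 2, 0)" ml] by (simp add: h_def r_def \<rho>_def)
    also have "\<theta> * r (K * ml) \<le> t * r (K * ml)" using \<theta> rK by (intro mult_right_mono)
    also have "(1 - \<theta>) * \<rho> \<le> \<rho>"
      using \<theta>1 r0 q \<delta> by (intro mult_left_le_one_le) (auto simp: \<rho>_def r_def risk_nonneg)
    finally show ?thesis using t by (simp add: algebra_simps)
  qed
  have high: "0 < H \<theta> ms"
  proof -
    define g where "g = min ((1 - \<delta>) / 2) \<gamma>"
    have "0 < g" using \<delta> \<open>0 < \<gamma>\<close> by (simp add: g_def)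
    have "\<delta> + g \<le> h \<theta> ms w" if "w \<in> A" for w
    proof -
      obtain l p where w: "w = (l, p)" "0 \<le> l" "0 \<le> p" "p \<le> 1" using \<open>w \<in> A\<close> by (auto simp: A_def)
      have "\<theta> * (\<delta> + g) \<le> \<theta> * risk p l (K * ms)"
        using far[OF w(3,4,2), of ms] ml \<theta> by (intro mult_left_mono) (auto simp: g_def)
      moreover have "(1 - \<theta>) * (\<delta> + g) \<le> (1 - \<theta>) * (q * risk p l ms + (1 - q) * risk p l 0)"
        using barrier[OF w(3,4,2)] \<theta>1 by (intro mult_left_mono) (auto simp: g_def)
      ultimately show ?thesis by (simp add: h_def w algebra_simps)
    qed
    from H_ge[OF this] \<open>0 < g\<close> show ?thesis by simp
  qed
  obtain z d where zd: "0 < d" "ml \<le> z - d" "z + d \<le> ms" "H \<theta> z = 0"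
    "\<forall>m\<in>{z - d<..<z}. H \<theta> m < 0" "\<forall>m\<in>{z<..<z + d}. 0 < H \<theta> m"
    by (rule sign_change_of_finite_zeros[OF ml(2) cont low high fin])
  \<comment> \<open>With atoms 1 and \<open>K\<close>, the scaled signals at noise level \<sigma>
    are m and K m for m = 1/\<sigma>.\<close>
  define P where "P = three_point \<theta> q 1 K"
  have Psi_eq: "Psi P \<delta> 0 (\<sigma>\<^sup>2) = \<sigma>\<^sup>2 / \<delta> * (H \<theta> (1 / \<sigma>) + \<delta>)" if "0 < \<sigma>" for \<sigma>
  proof -
    have int: "(\<integral>x. risk p l (x / \<sigma>) \<partial>P) = h \<theta> (1 / \<sigma>) (l, p)" if "0 \<le> p" "0 \<le> l" for p l
    proof -
      have "0 \<le> \<theta>" "\<theta> \<le> 1" "q \<le> 1" using \<theta>1 q \<delta> by auto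
      then show ?thesis
        using integral_risk_three_point[OF that, where \<theta> = \<theta> and q = q and \<sigma> = \<sigma> and x = 1 and y = K] q(1) by (simp add: P_def h_def)
    qed
    have P: "prob_space P" "sets P = sets borel" "integrable P (\<lambda>x. x\<^sup>2)"
      unfolding P_def by (intro prob_space_three_point sets_three_point integrable_three_point; simp)+
    have "0 < \<sigma>\<^sup>2 / \<delta>" using \<open>0 < \<sigma>\<close> \<delta> by simp
    show ?thesis
    proof (rule antisym)
      have "Psi P \<delta> 0 (\<sigma>\<^sup>2) / (\<sigma>\<^sup>2 / \<delta>) \<le> h \<theta> (1 / \<sigma>) w" if "w \<in> A" for w
      proof -
        obtain l p where w: "w = (l, p)" "0 \<le> l" "0 \<le> p" "p \<le> 1" using \<open>w \<in> A\<close> by (auto simp: A_def)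
        show ?thesis
          unfolding pos_divide_le_eq[OF \<open>0 < \<sigma>\<^sup>2 / \<delta>\<close>] w(1) int[OF w(3,2), symmetric]
          using Psi_le[OF P w(3,4,2) \<open>0 < \<sigma>\<close> \<delta>(1)] by (simp only: mult.commute)
      qed
      from H_ge[OF this] have "Psi P \<delta> 0 (\<sigma>\<^sup>2) / (\<sigma>\<^sup>2 / \<delta>) \<le> H \<theta> (1 / \<sigma>) + \<delta>" by linarith
      then show "Psi P \<delta> 0 (\<sigma>\<^sup>2) \<le> \<sigma>\<^sup>2 / \<delta> * (H \<theta> (1 / \<sigma>) + \<delta>)"
        unfolding pos_divide_le_eq[OF \<open>0 < \<sigma>\<^sup>2 / \<delta>\<close>] by (simp only: mult.commute)
      show "\<sigma>\<^sup>2 / \<delta> * (H \<theta> (1 / \<sigma>) + \<delta>) \<le> Psi P \<delta> 0 (\<sigma>\<^sup>2)"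
      proof (rule Psi_ge[OF P _ \<open>0 < \<sigma>\<close> \<delta>(1)])
        fix p l :: real assume "0 \<le> p" "p \<le> 1" "0 \<le> l"
        then show "H \<theta> (1 / \<sigma>) + \<delta> \<le> (\<integral>x. risk p l (x / \<sigma>) \<partial>P)"
          using int[of p l] H_le[OF \<theta>1, of "(l, p)" "1 / \<sigma>"] by (simp add: A_def)
      qed
    qed
  qed
  have Psi_diff: "Psi P \<delta> 0 (\<sigma>\<^sup>2) - \<sigma>\<^sup>2 = \<sigma>\<^sup>2 / \<delta> * H \<theta> (1 / \<sigma>)" if "0 < \<sigma>" for \<sigma>
    using \<delta> by (simp add: Psi_eq[OF that] distrib_left)
  have "0 < z - d" using zd(2) ml(1) by simp
  \<comment> \<open>Inversion reverses the order: the change of \<open>H\<close> from negative to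
    positive in m becomes a change from above to below the diagonal in \<sigma>, as stability
    demands.\<close>
  have "stable_fixed_point (Psi P \<delta> 0) (1 / z)"
    unfolding stable_fixed_point_def
  proof (intro disjI1 conjI exI allI impI)
    show "0 < 1 / z" using \<open>0 < z - d\<close> zd(1) by simp
    then show "Psi P \<delta> 0 ((1 / z)\<^sup>2) = (1 / z)\<^sup>2" using Psi_diff[of "1 / z"] zd(4) by simp
    show "0 \<le> 1 / (z + d)" using \<open>0 < z - d\<close> zd(1) by simp
    show "1 / (z + d) < 1 / z" "1 / z < 1 / (z - d)"
      using \<open>0 < z - d\<close> zd(1) by (auto intro!: divide_strict_left_mono mult_pos_pos)
    fix \<sigma> assume "1 / z < \<sigma> \<and> \<sigma> < 1 / (z - d)"
    then have \<sigma>: "1 / z < \<sigma>" "\<sigma> < 1 / (z - d)" "0 < \<sigma>"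
      using \<open>0 < 1 / z\<close> by linarith+
    then have "1 < \<sigma> * z" "\<sigma> * (z - d) < 1"
      using \<open>0 < z - d\<close> zd(1) pos_divide_less_eq[of z 1 \<sigma>] pos_less_divide_eq[of "z - d" \<sigma> 1] by linarith+
    then have "z - d < 1 / \<sigma>" "1 / \<sigma> < z"
      using pos_less_divide_eq[OF \<sigma>(3), of "z - d" 1] pos_divide_less_eq[OF \<sigma>(3), of 1 z]
      by (simp_all only: mult.commute[of \<sigma>])
    then have "\<sigma>\<^sup>2 / \<delta> * H \<theta> (1 / \<sigma>) < 0"
      using zd(5) \<sigma> \<delta> by (intro mult_pos_neg) auto
    then show "Psi P \<delta> 0 (\<sigma>\<^sup>2) < \<sigma>\<^sup>2" using Psi_diff[OF \<sigma>(3)] by simp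
  next
    fix \<sigma> assume "1 / (z + d) < \<sigma> \<and> \<sigma> < 1 / z"
    moreover have "0 < 1 / (z + d)" using \<open>0 < z - d\<close> zd(1) by simp
    ultimately have \<sigma>: "1 / (z + d) < \<sigma>" "\<sigma> < 1 / z" "0 < \<sigma>" by linarith+
    then have "1 < \<sigma> * (z + d)" "\<sigma> * z < 1"
      using \<open>0 < z - d\<close> zd(1) pos_divide_less_eq[of "z + d" 1 \<sigma>] pos_less_divide_eq[of z \<sigma> 1] by linarith+
    then have "z < 1 / \<sigma>" "1 / \<sigma> < z + d"
      using pos_less_divide_eq[OF \<sigma>(3), of z 1] pos_divide_less_eq[OF \<sigma>(3), of 1 "z + d"]
      by (simp_all only: mult.commute[of \<sigma>])
    then have "0 < \<sigma>\<^sup>2 / \<delta> * H \<theta> (1 / \<sigma>)"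
      using zd(6) \<sigma> \<delta> by (intro mult_pos_pos) auto
    then show "\<sigma>\<^sup>2 < Psi P \<delta> 0 (\<sigma>\<^sup>2)" using Psi_diff[OF \<sigma>(3)] by simp
  qed
  moreover have "stable_fixed_point (Psi P \<delta> 0) 0"
    unfolding P_def using \<theta> t q \<delta> \<open>1 \<le> K\<close> by (intro stable_zero_three_point) auto
  moreover have "P \<in> sparse_dists \<epsilon>"
    unfolding P_def using \<theta> t q \<delta> by (intro three_point_sparse) auto
  moreover have "0 < 1 / z" using \<open>0 < z - d\<close> zd(1) by simp
  ultimately show ?thesis by blast
qed

text \<open>As the risk is even in the signal, the hypothesis bounds it pointwise by
  \<open>risk p l 0\<close> plus B times the indicator of a nonzero signal, with B = (d - risk p l
  0)/\<epsilon>. Integrating over a mass of at most \<epsilon> gives \<open>d\<close>, because B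
  \<ge> 0 by the hypothesis at m = 0. The division forces a separate case \<epsilon> = 0.\<close>

lemma integral_risk_le_of_two_point_le:
  assumes P: "P \<in> sparse_dists \<epsilon>" and \<epsilon>: "0 \<le> \<epsilon>" and pl: "0 \<le> p" "0 \<le> l" and "0 < \<sigma>"
    and le: "\<And>m. 0 \<le> m \<Longrightarrow> two_point_risk \<epsilon> p l m \<le> d"
  shows "(\<integral>x. risk p l (x / \<sigma>) \<partial>P) \<le> d"
proof -
  have P': "prob_space P" "sets P = sets borel" "integrable P (\<lambda>x. x\<^sup>2)" "measure P {x. x \<noteq> 0} \<le> \<epsilon>"
    using P by (simp_all add: sparse_dists_def)
  interpret P: prob_space P by fact
  note [measurable_cong] = P'(2)
  have meas: "{x. x \<noteq> 0} \<in> sets P" unfolding P'(2) by measurable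
  have r0: "risk p l 0 \<le> d" using le[of 0] by (simp add: two_point_risk_eq algebra_simps)
  have even_le: "(1 - \<epsilon>) * risk p l 0 + \<epsilon> * risk p l m \<le> d" for m
  proof -
    have "risk p l \<bar>m\<bar> = risk p l m" using risk_minus[OF pl, of m] by (simp add: abs_if)
    then show ?thesis using le[of "\<bar>m\<bar>"] by (simp add: two_point_risk_eq)
  qed
  have int: "integrable P (\<lambda>x. risk p l (x / \<sigma>))" by (rule integrable_risk_scaled[OF P'(1-3) pl])
  show ?thesis
  proof (cases "\<epsilon> = 0")
    case True
    then have "measure P {x. x \<noteq> 0} = 0" using P'(4) by (simp add: measure_le_0_iff)
    then have "{x. x \<noteq> 0} \<in> null_sets P" using meas by (simp add: P.emeasure_eq_measure null_setsI)
    then have "AE x in P. x = 0" by (rule AE_I') auto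
    then have "(\<integral>x. risk p l (x / \<sigma>) \<partial>P) = (\<integral>x. risk p l 0 \<partial>P)"
      using int by (intro integral_cong_AE) auto
    then show ?thesis using r0 P.prob_space by simp
  next
    case False
    define B where "B = (d - risk p l 0) / \<epsilon>"
    have "0 < \<epsilon>" using False \<epsilon> by simp
    then have "0 \<le> B" using r0 by (simp add: B_def)
    have "(\<integral>x. risk p l (x / \<sigma>) \<partial>P) \<le> (\<integral>x. risk p l 0 + B * indicator {x. x \<noteq> 0} x \<partial>P)"
    proof (rule integral_mono[OF int])
      show "integrable P (\<lambda>x. risk p l 0 + B * indicator {x. x \<noteq> 0} x)"
        using meas by (auto simp: less_top[symmetric])
      fix x
      have "\<epsilon> * (risk p l (x / \<sigma>) - risk p l 0) \<le> d - risk p l 0"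
        using even_le[of "x / \<sigma>"] by (simp add: algebra_simps)
      then have "risk p l (x / \<sigma>) - risk p l 0 \<le> B"
        using \<open>0 < \<epsilon>\<close> by (simp add: B_def field_simps)
      then show "risk p l (x / \<sigma>) \<le> risk p l 0 + B * indicator {x. x \<noteq> 0} x"
        by (cases "x = 0") auto
    qed
    also have "\<dots> = risk p l 0 + B * measure P {x. x \<noteq> 0}"
      using meas P.prob_space by (simp add: less_top[symmetric])
    also have "\<dots> \<le> risk p l 0 + B * \<epsilon>"
      using P'(4) \<open>0 \<le> B\<close> by (intro add_left_mono mult_left_mono)
    also have "\<dots> = d" using \<open>0 < \<epsilon>\<close> by (simp add: B_def)
    finally show ?thesis .
  qed
qed

theorem theorem5:
  fixes \<delta> \<epsilon> \<sigma>w :: real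
  assumes "0 < \<delta>" "\<delta> < 1" and "0 \<le> \<epsilon>" "\<epsilon> \<le> 1" and "\<sigma>w = 0"
  shows
    "((INF p\<in>{0..1}. M_bar p \<epsilon>) < ereal \<delta> \<longrightarrow>
        (\<forall>P \<in> sparse_dists \<epsilon>. {\<sigma>. stable_fixed_point (Psi P \<delta> \<sigma>w) \<sigma>} = {0})) \<and>
     ((SUP \<mu>\<in>{0..}. INF p\<in>{0..1}. INF \<tau>\<in>{0..}. ereal (two_point_risk \<epsilon> p \<tau> \<mu>)) > ereal \<delta> \<longrightarrow>
        (\<exists>P \<in> sparse_dists \<epsilon>.
           stable_fixed_point (Psi P \<delta> \<sigma>w) 0 \<and>
           (\<exists>\<sigma>f > 0. stable_fixed_point (Psi P \<delta> \<sigma>w) \<sigma>f)))"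
proof (intro conjI impI ballI)
  fix P assume "(INF p\<in>{0..1}. M_bar p \<epsilon>) < ereal \<delta>" and P: "P \<in> sparse_dists \<epsilon>"
  then obtain p l where p: "0 \<le> p" "p \<le> 1" "0 \<le> l"
    and "(SUP \<mu>\<in>{0..}. ereal (two_point_risk \<epsilon> p l \<mu>)) < ereal \<delta>"
    by (auto simp: INF_less_iff M_bar_def)
  then obtain d where d: "(SUP \<mu>\<in>{0..}. ereal (two_point_risk \<epsilon> p l \<mu>)) < ereal d" "d < \<delta>"
    using ereal_dense2[of _ "ereal \<delta>"] by auto
  have le: "two_point_risk \<epsilon> p l m \<le> d" if "0 \<le> m" for m
  proof -
    have "ereal (two_point_risk \<epsilon> p l m) \<le> (SUP \<mu>\<in>{0..}. ereal (two_point_risk \<epsilon> p l \<mu>))"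
      using that by (intro SUP_upper) auto
    then show ?thesis using d(1) by (metis ereal_less_eq(3) less_imp_le order.strict_trans1)
  qed
  have below: "Psi P \<delta> \<sigma>w (\<sigma>\<^sup>2) < \<sigma>\<^sup>2" if "0 < \<sigma>" for \<sigma>
  proof -
    have "Psi P \<delta> 0 (\<sigma>\<^sup>2) \<le> \<sigma>\<^sup>2 / \<delta> * (\<integral>x. risk p l (x / \<sigma>) \<partial>P)"
      using P that assms p by (intro Psi_le) (auto simp: sparse_dists_def)
    also have "\<dots> \<le> \<sigma>\<^sup>2 / \<delta> * d"
      using assms p that by (intro mult_left_mono integral_risk_le_of_two_point_le[OF P] le) auto
    also have "\<dots> < \<sigma>\<^sup>2 / \<delta> * \<delta>"
      using d(2) that assms by (intro mult_strict_left_mono) auto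
    finally show ?thesis using assms by simp
  qed
  then have "stable_fixed_point (Psi P \<delta> \<sigma>w) 0"
    using assms by (auto simp: stable_fixed_point_def Psi_zero intro: exI[of _ 1])
  moreover have "\<sigma> = 0" if "stable_fixed_point (Psi P \<delta> \<sigma>w) \<sigma>" for \<sigma>
    using that below[of \<sigma>] by (auto simp: stable_fixed_point_def)
  ultimately show "{\<sigma>. stable_fixed_point (Psi P \<delta> \<sigma>w) \<sigma>} = {0}" by auto
next
  assume "(SUP \<mu>\<in>{0..}. INF p\<in>{0..1}. INF \<tau>\<in>{0..}. ereal (two_point_risk \<epsilon> p \<tau> \<mu>)) > ereal \<delta>"
  then obtain \<mu> where \<mu>: "0 \<le> \<mu>"
    "ereal \<delta> < (INF p\<in>{0..1}. INF \<tau>\<in>{0..}. ereal (two_point_risk \<epsilon> p \<tau> \<mu>))"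
    by (auto simp: less_SUP_iff)
  then obtain d where d: "\<delta> < d"
    "ereal d < (INF p\<in>{0..1}. INF \<tau>\<in>{0..}. ereal (two_point_risk \<epsilon> p \<tau> \<mu>))"
    using ereal_dense2[of "ereal \<delta>"] by auto
  have ge: "d \<le> (1 - \<epsilon>) * risk p l 0 + \<epsilon> * risk p l \<mu>" if "0 \<le> p" "p \<le> 1" "0 \<le> l" for p l
  proof -
    have "(INF p\<in>{0..1}. INF \<tau>\<in>{0..}. ereal (two_point_risk \<epsilon> p \<tau> \<mu>)) \<le> ereal (two_point_risk \<epsilon> p l \<mu>)"
      using that by (intro INF_lower2[of p] INF_lower2[of l]) auto
    then have "ereal d < ereal (two_point_risk \<epsilon> p l \<mu>)" using d(2) by (rule less_le_trans[rotated])
    then show ?thesis by (simp add: two_point_risk_eq)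
  qed
  obtain a where a: "0 < a" "risk 0 (a\<^sup>2 / 2) 0 < \<delta>"
    using hard_threshold_small_risk[OF assms(1)] by auto
  \<comment> \<open>Otherwise the two-point risk is the risk at the zero signal, which hard
    thresholding brings below \<delta>.\<close>
  have "\<epsilon> \<noteq> 0" "\<mu> \<noteq> 0"
    using ge[of 0 "a\<^sup>2 / 2"] a d(1) by (auto simp: algebra_simps)
  text \<open>
    For \<open>\<epsilon> \<ge> \<delta>\<close> a mass \<open>\<epsilon>\<close> off zero would destroy the stability of zero, but a mass just below
    \<open>\<delta>\<close> is enough for an extra fixed point.
  \<close>
  obtain q0 m \<gamma> where q0: "0 < q0" "q0 \<le> \<epsilon>" "q0 \<le> \<delta>" and m: "0 < m" and "0 < \<gamma>"
    and barrier: "\<And>p l. 0 \<le> p \<Longrightarrow> p \<le> 1 \<Longrightarrow> 0 \<le> l \<Longrightarrow>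
      \<delta> + \<gamma> \<le> (1 - q0) * risk p l 0 + q0 * risk p l m"
  proof (cases "\<epsilon> < \<delta>")
    case True
    show thesis
      using that[of \<epsilon> \<mu> "d - \<delta>"] ge True \<open>\<epsilon> \<noteq> 0\<close> \<open>\<mu> \<noteq> 0\<close> \<open>0 \<le> \<mu>\<close> assms d by simp
  next
    case False
    obtain m \<gamma> where "0 < m" "0 < \<gamma>"
      "\<And>p l. 0 \<le> p \<Longrightarrow> p \<le> 1 \<Longrightarrow> 0 \<le> l \<Longrightarrow> \<delta> + \<gamma> \<le> (1 - \<delta>) * risk p l 0 + \<delta> * risk p l m"
      using two_point_risk_barrier[OF assms(1,2)] by blast
    then show thesis using that[of \<delta> m \<gamma>] False assms by simp
  qed
  define B where "B = 8 * m\<^sup>2 + 2"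
  have "0 < B" by (simp add: B_def add_nonneg_pos)
  \<comment> \<open>Lowering the mass from \<open>q0\<close> by \<open>e\<close> makes room,
    strictly below \<epsilon> and \<delta>, for the far atom. The risk at \<open>m\<close> is at
    most \<open>B\<close>, so this costs at most half of the barrier height \<gamma>.\<close>
  define e where "e = min (q0 / 2) (\<gamma> / (2 * B))"
  have e: "0 < e" "e \<le> q0 / 2" "e * B \<le> \<gamma> / 2"
  proof -
    show "0 < e" using q0 \<open>0 < \<gamma>\<close> \<open>0 < B\<close> by (simp add: e_def)
    show "e \<le> q0 / 2" by (simp add: e_def)
    have "e \<le> \<gamma> / (2 * B)" by (simp add: e_def)
    then show "e * B \<le> \<gamma> / 2" using \<open>0 < B\<close> by (simp add: field_simps)
  qed
  have "\<delta> + \<gamma> / 2 \<le> (1 - (q0 - e)) * risk p l 0 + (q0 - e) * risk p l m"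
    if "0 \<le> p" "p \<le> 1" "0 \<le> l" for p l
  proof -
    have "e * risk p l m \<le> e * B"
      unfolding B_def using risk_le[OF that(1,3), of m] e by (intro mult_left_mono) auto
    moreover have "0 \<le> e * risk p l 0" using e by (simp add: risk_nonneg)
    moreover have "(1 - (q0 - e)) * risk p l 0 + (q0 - e) * risk p l m =
        ((1 - q0) * risk p l 0 + q0 * risk p l m) + e * risk p l 0 - e * risk p l m"
      by (simp add: algebra_simps)
    ultimately show ?thesis using barrier[OF that] e(3) by linarith
  qed
  then have "\<exists>P\<in>sparse_dists \<epsilon>. stable_fixed_point (Psi P \<delta> 0) 0 \<and>
      (\<exists>\<sigma>f>0. stable_fixed_point (Psi P \<delta> 0) \<sigma>f)"
    using assms q0 m e \<open>0 < \<gamma>\<close>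
    by (intro exists_extra_stable_fixed_point[where q = "q0 - e" and ms = m and \<gamma> = "\<gamma> / 2"]) auto
  then show "\<exists>P \<in> sparse_dists \<epsilon>. stable_fixed_point (Psi P \<delta> \<sigma>w) 0 \<and>
      (\<exists>\<sigma>f > 0. stable_fixed_point (Psi P \<delta> \<sigma>w) \<sigma>f)"
    using assms by simp
qed

end
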